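(* Let $p=p_n$ and suppose $\min\{p,n\}\to\infty$. Then for all sufficiently small $\varepsilon>0$, $$\liminf_{n\to\infty}\ \inf_{\phi\in\mathcal{T}_n}\Big\{\mathbb{P}_{\mu_0}(\phi=1)+\sup_{\nu:\ d(\nu,\mu_0)\ge\varepsilon/n}\mathbb{P}_\nu(\phi=0)\Big\}\ \ge\ \frac14 ,$$ where the supremum is over all Borel probability measures $\nu$ on $\mathbb{S}^{p-1}$ with $d(\nu,\mu_0)\ge\varepsilon/n$.
   Context: $\mathbb{S}^{p-1}=\{x\in\mathbb{R}^p:\|x\|_2=1\}$ and $\mu_0$ is the uniform distribution on $\mathbb{S}^{p-1}$. $\mathcal{T}_n$ is the set of all tests $\phi=\phi(X_1,\dots,X_n):(\mathbb{S}^{p-1})^n\to\{0,1\}$ (measurable functions of a sample of size $n$). $\mathbb{P}_\nu(\phi=\cdot)$ is computed with $X_1,\dots,X_n$ i.i.d. from $\nu$. For probability measures $\mu,\nu$ on $\mathbb{S}^{p-1}$, $$d(\mu,\nu)=\sup_{t\in[-1,1]}\big|\mathbb{P}_\mu(X_1^\top Y_1\le t)-\mathbb{P}_\nu(X^\top Y\le t)\big|,$$ where $X_1,Y_1$ are drawn independently from $\mu$ and $X,Y$ independently from $\nu$. *)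

theory Defs
  imports "HOL-Probability.Probability"
begin

text \<open>
  Since the dimension varies with the sample size, a vector of \<open>\<real>\<^sup>p\<close> is represented by its
  coordinate function, extensional on \<open>{..<p}\<close>; the product sigma-algebra of \<open>p\<close> copies of
  the real line is the Borel sigma-algebra of \<open>\<real>\<^sup>p\<close>.
\<close>

definition unit_sphere :: "nat \<Rightarrow> (nat \<Rightarrow> real) set" where
  "unit_sphere p = {x \<in> {..<p} \<rightarrow>\<^sub>E UNIV. L2_set x {..<p} = 1}"

definition sphere_borel :: "nat \<Rightarrow> (nat \<Rightarrow> real) measure" where
  "sphere_borel p = restrict_space (\<Pi>\<^sub>M i\<in>{..<p}. borel) (unit_sphere p)"

definition sphere_probs :: "nat \<Rightarrow> (nat \<Rightarrow> real) measure set" where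
  "sphere_probs p = {\<nu>. prob_space \<nu> \<and> sets \<nu> = sets (sphere_borel p)}"

definition vec_normalize :: "nat \<Rightarrow> (nat \<Rightarrow> real) \<Rightarrow> (nat \<Rightarrow> real)" where
  "vec_normalize p x = (\<lambda>i\<in>{..<p}. x i / L2_set x {..<p})"

text \<open>
  The uniform distribution on the sphere as normalised cone measure: the law of \<open>U / \<parallel>U\<parallel>\<close> for
  \<open>U\<close> uniform (with respect to Lebesgue measure) on the closed unit ball. The origin, which is
  not mapped to the sphere, is a null set for \<open>p \<ge> 1\<close>, so the restriction keeps total mass 1.
\<close>

definition uniform_sphere :: "nat \<Rightarrow> (nat \<Rightarrow> real) measure" where
  "uniform_sphere p =
     restrict_space
       (distr (uniform_measure (\<Pi>\<^sub>M i\<in>{..<p}. lborel) {x \<in> {..<p} \<rightarrow>\<^sub>E UNIV. L2_set x {..<p} \<le> 1})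
              (\<Pi>\<^sub>M i\<in>{..<p}. borel) (vec_normalize p))
       (unit_sphere p)"

definition inner_cdf :: "nat \<Rightarrow> (nat \<Rightarrow> real) measure \<Rightarrow> real \<Rightarrow> real" where
  "inner_cdf p \<nu> t =
     measure (\<nu> \<Otimes>\<^sub>M \<nu>) {(x, y) \<in> space (\<nu> \<Otimes>\<^sub>M \<nu>). (\<Sum>i<p. x i * y i) \<le> t}"

definition inner_dist :: "nat \<Rightarrow> (nat \<Rightarrow> real) measure \<Rightarrow> (nat \<Rightarrow> real) measure \<Rightarrow> real" where
  "inner_dist p \<mu> \<nu> = (SUP t\<in>{-1..1}. \<bar>inner_cdf p \<mu> t - inner_cdf p \<nu> t\<bar>)"

definition sphere_tests :: "nat \<Rightarrow> nat \<Rightarrow> ((nat \<Rightarrow> nat \<Rightarrow> real) \<Rightarrow> nat) set" where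
  "sphere_tests p n = measurable (\<Pi>\<^sub>M i\<in>{..<n}. sphere_borel p) (count_space {0, 1})"

text \<open>
  Probabilities are taken in \<^typ>\<open>ennreal\<close>, a complete lattice, so that the infima, suprema
  and the limit inferior formed from them need no side conditions.
\<close>

definition test_prob ::
  "nat \<Rightarrow> (nat \<Rightarrow> real) measure \<Rightarrow> ((nat \<Rightarrow> nat \<Rightarrow> real) \<Rightarrow> nat) \<Rightarrow> nat \<Rightarrow> ennreal" where
  "test_prob n \<nu> \<phi> k =
     emeasure (\<Pi>\<^sub>M i\<in>{..<n}. \<nu>) {X \<in> space (\<Pi>\<^sub>M i\<in>{..<n}. \<nu>). \<phi> X = k}"

end

theory Submission imports Defs begin

text \<open>
  The alternatives tilt the signs of the coordinates: for a sign vector \<open>s\<close> let \<open>\<nu>\<^sub>s\<close> have density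
  \<open>\<Prod>i<p. 1 + a s\<^sub>i sgn x\<^sub>i\<close> with respect to \<open>\<mu>\<^sub>0\<close>, where \<open>a\<^sup>2 = b = 1 / (n \<surd>p)\<close>. The uniform distribution is
  invariant under flipping the sign of a coordinate, which gives two things.

  First, \<open>\<integral> (d\<nu>\<^sub>s/d\<mu>\<^sub>0) (d\<nu>\<^sub>t/d\<mu>\<^sub>0) d\<mu>\<^sub>0 = \<Prod>i<p. 1 + b s\<^sub>i t\<^sub>i\<close>, so the likelihood ratio \<open>l\<close> of the uniform mixture of
  the \<open>n\<close>-fold products has second moment \<open>(((1 + b)\<^sup>n + (1 - b)\<^sup>n) / 2)\<^sup>p \<le> exp (n\<^sup>2 b\<^sup>2 p) \<le> 3\<close>. As
  \<open>l - l\<^sup>2 / 4 \<le> min 1 l\<close>, the sum of the two error probabilities against the mixture is at least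
  \<open>1 - 3 / 4\<close>.

  Second, for independent \<open>X\<close> and \<open>Y\<close> the probability of \<open>X \<bullet> Y \<le> 0\<close> under \<open>\<nu>\<^sub>s\<close> is the \<open>\<mu>\<^sub>0\<close>-integral of
  \<open>\<Prod>i<p. 1 + b sgn (X\<^sub>i Y\<^sub>i)\<close> over that event. The linear term of this product contributes
  \<open>b E[S; X \<bullet> Y \<le> 0]\<close> with \<open>S = \<Sum>i<p. sgn (X\<^sub>i Y\<^sub>i)\<close>, which is negative of order \<open>b \<surd>p = 1 / n\<close>, and the remainder is
  of order \<open>b\<^sup>2 p = 1 / n\<^sup>2\<close>. Hence \<open>d(\<nu>\<^sub>s, \<mu>\<^sub>0)\<close> is at least a constant times \<open>1 / n\<close>.
\<close>

subsection \<open>Bounded measurable functions\<close>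

text \<open>Measurability and boundedness together give integrability under every finite measure, so
  for integrands built from bounded functions it follows from closure rules. The bound is asked only
  on \<open>space M\<close>, since coordinates are bounded only on the sphere.\<close>

definition bdd_mble :: "'a measure \<Rightarrow> ('a \<Rightarrow> real) \<Rightarrow> bool" where
  "bdd_mble M f \<longleftrightarrow> f \<in> borel_measurable M \<and> (\<exists>B. \<forall>x\<in>space M. \<bar>f x\<bar> \<le> B)"

lemma bdd_mbleI:
  assumes "f \<in> borel_measurable M" "\<And>x. x \<in> space M \<Longrightarrow> \<bar>f x\<bar> \<le> B"
  shows "bdd_mble M f"
  using assms by (auto simp: bdd_mble_def)

lemma bdd_mble_measurable: "bdd_mble M f \<Longrightarrow> f \<in> borel_measurable M"
  by (simp add: bdd_mble_def)

lemma bdd_mble_const: "bdd_mble M (\<lambda>x. c)"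
  by (auto simp: bdd_mble_def)

lemma bdd_mble_add:
  assumes "bdd_mble M f" "bdd_mble M g" shows "bdd_mble M (\<lambda>x. f x + g x)"
proof -
  obtain A B where "\<And>x. x \<in> space M \<Longrightarrow> \<bar>f x\<bar> \<le> A" "\<And>x. x \<in> space M \<Longrightarrow> \<bar>g x\<bar> \<le> B"
    using assms by (auto simp: bdd_mble_def)
  then have "\<And>x. x \<in> space M \<Longrightarrow> \<bar>f x + g x\<bar> \<le> A + B"
    by (meson abs_triangle_ineq add_mono order_trans)
  with assms show ?thesis by (intro bdd_mbleI) (auto simp: bdd_mble_def)
qed

lemma bdd_mble_mult:
  assumes "bdd_mble M f" "bdd_mble M g" shows "bdd_mble M (\<lambda>x. f x * g x)"
proof -
  obtain A B where *: "\<And>x. x \<in> space M \<Longrightarrow> \<bar>f x\<bar> \<le> A" "\<And>x. x \<in> space M \<Longrightarrow> \<bar>g x\<bar> \<le> B"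
    using assms by (auto simp: bdd_mble_def)
  have "\<bar>f x * g x\<bar> \<le> A * B" if "x \<in> space M" for x
    unfolding abs_mult using *[OF that] by (intro mult_mono) auto
  with assms show ?thesis by (intro bdd_mbleI) (auto simp: bdd_mble_def)
qed

lemma bdd_mble_diff:
  assumes "bdd_mble M f" "bdd_mble M g" shows "bdd_mble M (\<lambda>x. f x - g x)"
  using bdd_mble_add[OF assms(1) bdd_mble_mult[OF bdd_mble_const[of M "-1"] assms(2)]] by simp

lemma bdd_mble_minus: "bdd_mble M f \<Longrightarrow> bdd_mble M (\<lambda>x. - f x)"
  using bdd_mble_diff[OF bdd_mble_const[of M 0]] by simp

lemma bdd_mble_abs: "bdd_mble M f \<Longrightarrow> bdd_mble M (\<lambda>x. \<bar>f x\<bar>)"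
  by (auto simp: bdd_mble_def)

lemma bdd_mble_sgn: "bdd_mble M f \<Longrightarrow> bdd_mble M (\<lambda>x. sgn (f x))"
  by (auto simp: bdd_mble_def sgn_if intro!: exI[of _ 1])

lemma bdd_mble_power: "bdd_mble M f \<Longrightarrow> bdd_mble M (\<lambda>x. f x ^ k)"
  by (induction k) (auto intro: bdd_mble_const bdd_mble_mult)

lemma bdd_mble_sum:
  assumes "\<And>i. i \<in> I \<Longrightarrow> bdd_mble M (f i)" shows "bdd_mble M (\<lambda>x. \<Sum>i\<in>I. f i x)"
  using assms by (induction I rule: infinite_finite_induct) (auto intro: bdd_mble_const bdd_mble_add)

lemma bdd_mble_prod:
  assumes "\<And>i. i \<in> I \<Longrightarrow> bdd_mble M (f i)" shows "bdd_mble M (\<lambda>x. \<Prod>i\<in>I. f i x)"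
  using assms by (induction I rule: infinite_finite_induct) (auto intro: bdd_mble_const bdd_mble_mult)

lemma bdd_mble_compose:
  assumes "bdd_mble N f" "g \<in> measurable M N" shows "bdd_mble M (\<lambda>x. f (g x))"
  using assms measurable_space[OF assms(2)] measurable_compose[OF assms(2), of f borel]
  unfolding bdd_mble_def by blast

lemmas bdd_mble_intros = bdd_mble_const bdd_mble_add bdd_mble_mult bdd_mble_diff bdd_mble_minus
  bdd_mble_abs bdd_mble_sgn bdd_mble_power bdd_mble_sum bdd_mble_prod

lemma (in finite_measure) bdd_mble_integrable: "bdd_mble M f \<Longrightarrow> integrable M f"
  unfolding bdd_mble_def by (metis AE_I2 integrable_const_bound real_norm_def)

subsection \<open>Product Lebesgue measure and the uniform distribution on the sphere\<close>

text \<open>Fubini isolates coordinate \<open>i\<close>. Along it \<open>h x\<close> is constant by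
  \<open>h_upd\<close>, and Lebesgue measure on the line is invariant under translation and
  reflection. Flips are the case \<open>h = 0\<close>, \<open>e = -1\<close>; shears have
  \<open>e = 1\<close>.\<close>

lemma nn_integral_PiM_lborel_affine_update:
  fixes f :: "('i \<Rightarrow> real) \<Rightarrow> ennreal"
  assumes I: "finite I" "i \<in> I" and e: "\<bar>e\<bar> = 1"
    and f [measurable]: "f \<in> borel_measurable (\<Pi>\<^sub>M i\<in>I. lborel)"
    and h [measurable]: "h \<in> borel_measurable (\<Pi>\<^sub>M i\<in>I. lborel)"
    and h_upd: "\<And>x y. h (x(i := y)) = h x"
  shows "(\<integral>\<^sup>+x. f (x(i := h x + e * x i)) \<partial>(\<Pi>\<^sub>M i\<in>I. lborel)) = (\<integral>\<^sup>+x. f x \<partial>(\<Pi>\<^sub>M i\<in>I. lborel))"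
proof -
  interpret product_sigma_finite "\<lambda>_::'i. lborel :: real measure" ..
  define J where "J = I - {i}"
  have J: "finite J" "i \<notin> J" "I = insert i J"
    using I by (auto simp: J_def)
  have upd [measurable]: "(\<lambda>x. x(i := h x + e * x i)) \<in> measurable (\<Pi>\<^sub>M i\<in>I. lborel) (\<Pi>\<^sub>M i\<in>I. lborel)"
    using I by (intro measurable_fun_upd[where J=I]) auto
  have "(\<lambda>x. f (x(i := h x + e * x i))) \<in> borel_measurable (\<Pi>\<^sub>M i\<in>I. lborel)"
    by (rule measurable_compose[OF upd f])
  then have "(\<integral>\<^sup>+x. f (x(i := h x + e * x i)) \<partial>(\<Pi>\<^sub>M i\<in>I. lborel)) =
    (\<integral>\<^sup>+x. (\<integral>\<^sup>+y. f (x(i := h x + e * y)) \<partial>lborel) \<partial>(\<Pi>\<^sub>M i\<in>J. lborel))"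
    using product_nn_integral_insert[OF J(1,2), of "\<lambda>x. f (x(i := h x + e * x i))"] J(3)
    by (simp add: h_upd)
  also have "\<dots> = (\<integral>\<^sup>+x. (\<integral>\<^sup>+y. f (x(i := y)) \<partial>lborel) \<partial>(\<Pi>\<^sub>M i\<in>J. lborel))"
  proof (rule nn_integral_cong)
    fix x :: "'i \<Rightarrow> real" assume x: "x \<in> space (\<Pi>\<^sub>M i\<in>J. lborel)"
    have *: "(\<lambda>y. x(i := y)) \<in> measurable lborel (\<Pi>\<^sub>M i\<in>I. lborel)"
      using x J by (intro measurable_fun_upd[where J=J]) auto
    have "(\<lambda>y. f (x(i := y))) \<in> borel_measurable lborel"
      by (rule measurable_compose[OF * f])
    then show "(\<integral>\<^sup>+y. f (x(i := h x + e * y)) \<partial>lborel) = (\<integral>\<^sup>+y. f (x(i := y)) \<partial>lborel)"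
      using e nn_integral_real_affine[where c=e and t="h x" and f="\<lambda>y. f (x(i := y))"] by auto
  qed
  also have "\<dots> = (\<integral>\<^sup>+x. f x \<partial>(\<Pi>\<^sub>M i\<in>I. lborel))"
    using product_nn_integral_insert[OF J(1,2), of f] f J(3) by simp
  finally show ?thesis .
qed

lemma distr_PiM_lborel_affine_update:
  fixes h :: "('i \<Rightarrow> real) \<Rightarrow> real"
  assumes I: "finite I" "i \<in> I" and e: "\<bar>e\<bar> = 1"
    and h [measurable]: "h \<in> borel_measurable (\<Pi>\<^sub>M i\<in>I. lborel)"
    and h_upd: "\<And>x y. h (x(i := y)) = h x"
  shows "(\<lambda>x. x(i := h x + e * x i)) \<in> measurable (\<Pi>\<^sub>M i\<in>I. lborel) (\<Pi>\<^sub>M i\<in>I. lborel)" (is "?T \<in> _")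
    and "distr (\<Pi>\<^sub>M i\<in>I. lborel) (\<Pi>\<^sub>M i\<in>I. lborel) (\<lambda>x. x(i := h x + e * x i)) = (\<Pi>\<^sub>M i\<in>I. lborel)"
proof -
  show T [measurable]: "?T \<in> measurable (\<Pi>\<^sub>M i\<in>I. lborel) (\<Pi>\<^sub>M i\<in>I. lborel)"
    using I by (intro measurable_fun_upd[where J=I]) auto
  show "distr (\<Pi>\<^sub>M i\<in>I. lborel) (\<Pi>\<^sub>M i\<in>I. lborel) ?T = (\<Pi>\<^sub>M i\<in>I. lborel)"
  proof (rule measure_eqI)
    fix A assume "A \<in> sets (distr (\<Pi>\<^sub>M i\<in>I. lborel) (\<Pi>\<^sub>M i\<in>I. lborel) ?T)"
    then have A [measurable]: "A \<in> sets (\<Pi>\<^sub>M i\<in>I. lborel)" by simp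
    have "emeasure (distr (\<Pi>\<^sub>M i\<in>I. lborel) (\<Pi>\<^sub>M i\<in>I. lborel) ?T) A
        = (\<integral>\<^sup>+x. indicator A x \<partial>distr (\<Pi>\<^sub>M i\<in>I. lborel) (\<Pi>\<^sub>M i\<in>I. lborel) ?T)"
      using A by simp
    also have "\<dots> = (\<integral>\<^sup>+x. indicator A (?T x) \<partial>(\<Pi>\<^sub>M i\<in>I. lborel))"
      using A T by (intro nn_integral_distr) auto
    also have "\<dots> = emeasure (\<Pi>\<^sub>M i\<in>I. lborel) A"
      using A by (subst nn_integral_PiM_lborel_affine_update[OF I e _ h h_upd]) auto
    finally show "emeasure (distr (\<Pi>\<^sub>M i\<in>I. lborel) (\<Pi>\<^sub>M i\<in>I. lborel) ?T) A = emeasure (\<Pi>\<^sub>M i\<in>I. lborel) A" .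
  qed simp
qed

text \<open>By Fubini, since each line in direction \<open>i\<close> meets the hyperplane in a
  single point. This also disposes of the origin, which does not normalise to the sphere.\<close>

lemma AE_PiM_lborel_nonzero:
  assumes I: "finite I" "i \<in> I"
  shows "AE x in (\<Pi>\<^sub>M i\<in>I. lborel). x i \<noteq> (0::real)"
proof (rule AE_I)
  interpret product_sigma_finite "\<lambda>_::'a. lborel :: real measure" ..
  let ?N = "{x \<in> space (\<Pi>\<^sub>M i\<in>I. lborel). x i = (0::real)}"
  define J where "J = I - {i}"
  have J: "finite J" "i \<notin> J" "I = insert i J"
    using I by (auto simp: J_def)
  show N: "?N \<in> sets (\<Pi>\<^sub>M i\<in>I. lborel)"
    using I by measurable
  have ind: "(indicator {x. x i = (0::real)} :: _ \<Rightarrow> ennreal) \<in> borel_measurable (\<Pi>\<^sub>M i\<in>I. lborel)"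
    using N by (subst measurable_cong[where g="indicator ?N"]) (auto simp: indicator_def)
  have "emeasure (\<Pi>\<^sub>M i\<in>I. lborel) ?N = (\<integral>\<^sup>+x. indicator ?N x \<partial>(\<Pi>\<^sub>M i\<in>I. lborel))"
    using N by simp
  also have "\<dots> = (\<integral>\<^sup>+x. indicator {x. x i = (0::real)} x \<partial>(\<Pi>\<^sub>M i\<in>I. lborel))"
    by (intro nn_integral_cong) (auto simp: indicator_def)
  also have "\<dots> = (\<integral>\<^sup>+x. (\<integral>\<^sup>+y. indicator {0::real} y \<partial>lborel) \<partial>(\<Pi>\<^sub>M i\<in>J. (lborel :: real measure)))"
    using product_nn_integral_insert[OF J(1,2), of "indicator {x. x i = (0::real)}"] J(3) ind
    by (simp add: indicator_def[of "{x. x i = (0::real)}" "_(i := _)"] indicator_def[of "{0}"])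
  finally show "emeasure (\<Pi>\<^sub>M i\<in>I. lborel) ?N = 0"
    by simp
qed auto

section \<open>Volume of the unit ball and normalised cone measure\<close>

definition unit_ball :: "nat \<Rightarrow> (nat \<Rightarrow> real) set" where
  "unit_ball p = {x \<in> {..<p} \<rightarrow>\<^sub>E UNIV. L2_set x {..<p} \<le> 1}"

lemma sets_PiM_lborel: "sets (\<Pi>\<^sub>M i\<in>I. lborel) = sets (\<Pi>\<^sub>M i\<in>I. borel)"
  by (intro sets_PiM_cong) auto

lemma L2_set_measurable [measurable]:
  "(\<lambda>x. L2_set x {..<p}) \<in> borel_measurable (\<Pi>\<^sub>M i\<in>{..<p}. borel)"
  unfolding L2_set_def by measurable

lemma unit_ball_sets: "unit_ball p \<in> sets (\<Pi>\<^sub>M i\<in>{..<p}. borel)"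
proof -
  have "unit_ball p = {x \<in> space (\<Pi>\<^sub>M i\<in>{..<p}. borel). L2_set x {..<p} \<le> 1}"
    by (auto simp: unit_ball_def space_PiM)
  also have "\<dots> \<in> sets (\<Pi>\<^sub>M i\<in>{..<p}. borel)" by measurable
  finally show ?thesis .
qed

lemma unit_sphere_sets: "unit_sphere p \<in> sets (\<Pi>\<^sub>M i\<in>{..<p}. borel)"
proof -
  have "unit_sphere p = {x \<in> space (\<Pi>\<^sub>M i\<in>{..<p}. borel). L2_set x {..<p} = 1}"
    by (auto simp: unit_sphere_def space_PiM)
  also have "\<dots> \<in> sets (\<Pi>\<^sub>M i\<in>{..<p}. borel)" by measurable
  finally show ?thesis .
qed

lemma vec_normalize_measurable:
  "vec_normalize p \<in> measurable (\<Pi>\<^sub>M i\<in>{..<p}. borel) (\<Pi>\<^sub>M i\<in>{..<p}. borel)"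
  unfolding vec_normalize_def by measurable

text \<open>The ball lies between two cubes of positive finite volume, so normalising Lebesgue
  measure on it gives a probability measure.\<close>

lemma emeasure_unit_ball:
  assumes "p \<ge> 1"
  shows "emeasure (\<Pi>\<^sub>M i\<in>{..<p}. lborel) (unit_ball p) \<noteq> 0"
    and "emeasure (\<Pi>\<^sub>M i\<in>{..<p}. lborel) (unit_ball p) \<noteq> \<infinity>"
proof -
  interpret product_sigma_finite "\<lambda>_::nat. lborel :: real measure" ..
  have U: "unit_ball p \<in> sets (\<Pi>\<^sub>M i\<in>{..<p}. lborel)"
    using unit_ball_sets by (simp add: sets_PiM_lborel)
  \<comment> \<open>Side \<open>1 / p\<close> keeps the sum of the absolute coordinates, which
    dominates the Euclidean norm, at most 1.\<close>
  have "(\<Pi>\<^sub>E i\<in>{..<p}. {0..1 / real p}) \<subseteq> unit_ball p"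
  proof
    fix x assume x: "x \<in> (\<Pi>\<^sub>E i\<in>{..<p}. {0..1 / real p})"
    have "L2_set x {..<p} \<le> (\<Sum>i<p. \<bar>x i\<bar>)"
      by (rule L2_set_le_sum_abs)
    also have "\<dots> \<le> (\<Sum>i<p. 1 / real p)"
      using x by (intro sum_mono) (auto simp: PiE_def Pi_def)
    also have "\<dots> = 1"
      using assms by simp
    finally show "x \<in> unit_ball p"
      using x by (auto simp: unit_ball_def PiE_def)
  qed
  then have "emeasure (\<Pi>\<^sub>M i\<in>{..<p}. lborel) (\<Pi>\<^sub>E i\<in>{..<p}. {0..1 / real p})
      \<le> emeasure (\<Pi>\<^sub>M i\<in>{..<p}. lborel) (unit_ball p)"
    by (intro emeasure_mono U)
  moreover have "emeasure (\<Pi>\<^sub>M i\<in>{..<p}. lborel) (\<Pi>\<^sub>E i\<in>{..<p}. {0..1 / real p}) \<noteq> 0"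
    using assms by (subst emeasure_PiM) auto
  ultimately show "emeasure (\<Pi>\<^sub>M i\<in>{..<p}. lborel) (unit_ball p) \<noteq> 0"
    by auto
  have "unit_ball p \<subseteq> (\<Pi>\<^sub>E i\<in>{..<p}. {-1..1::real})"
  proof
    fix x assume x: "x \<in> unit_ball p"
    have "x i \<in> {-1..1}" if "i < p" for i
    proof -
      have "\<bar>x i\<bar> \<le> L2_set (\<lambda>i. \<bar>x i\<bar>) {..<p}"
        using that by (intro member_le_L2_set) auto
      also have "\<dots> \<le> 1"
        using x by (simp add: unit_ball_def L2_set_def)
      finally show ?thesis
        by (simp add: abs_le_iff)
    qed
    then show "x \<in> (\<Pi>\<^sub>E i\<in>{..<p}. {-1..1::real})"
      using x unfolding unit_ball_def PiE_def Pi_def by blast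
  qed
  then have "emeasure (\<Pi>\<^sub>M i\<in>{..<p}. lborel) (unit_ball p)
      \<le> emeasure (\<Pi>\<^sub>M i\<in>{..<p}. lborel) (\<Pi>\<^sub>E i\<in>{..<p}. {-1..1::real})"
    by (intro emeasure_mono sets_PiM_I_finite) auto
  also have "\<dots> = (\<Prod>i<p. 2)"
    by (subst emeasure_PiM) auto
  also have "\<dots> < \<infinity>"
    by (simp add: power_less_top_ennreal)
  finally show "emeasure (\<Pi>\<^sub>M i\<in>{..<p}. lborel) (unit_ball p) \<noteq> \<infinity>"
    by simp
qed

lemma space_uniform_sphere: "space (uniform_sphere p) = unit_sphere p"
proof -
  have "unit_sphere p \<subseteq> space (\<Pi>\<^sub>M i\<in>{..<p}. borel)"
    by (auto simp: unit_sphere_def space_PiM)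
  then show ?thesis
    by (auto simp: uniform_sphere_def space_restrict_space)
qed

lemma sets_uniform_sphere: "sets (uniform_sphere p) = sets (sphere_borel p)"
  unfolding uniform_sphere_def sphere_borel_def
  by (intro sets_restrict_space_cong) simp

text \<open>The mass of \<open>A\<close> is the share of the volume of the ball that the cone over
  \<open>A\<close> occupies; invariance of the uniform distribution thus reduces to invariance of
  Lebesgue measure.\<close>

lemma emeasure_uniform_sphere:
  assumes "A \<in> sets (sphere_borel p)"
  shows "emeasure (uniform_sphere p) A =
    emeasure (\<Pi>\<^sub>M i\<in>{..<p}. lborel) (unit_ball p \<inter> (vec_normalize p -` A \<inter> space (\<Pi>\<^sub>M i\<in>{..<p}. borel))) /
    emeasure (\<Pi>\<^sub>M i\<in>{..<p}. lborel) (unit_ball p)"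
proof -
  let ?U = "uniform_measure (\<Pi>\<^sub>M i\<in>{..<p}. lborel) (unit_ball p)"
  have A: "A \<subseteq> unit_sphere p" "A \<in> sets (\<Pi>\<^sub>M i\<in>{..<p}. borel)"
    using assms unit_sphere_sets[of p] unfolding sphere_borel_def by (auto simp: sets_restrict_space_iff)
  have N: "vec_normalize p \<in> measurable ?U (\<Pi>\<^sub>M i\<in>{..<p}. borel)"
    using vec_normalize_measurable by (simp add: measurable_def space_PiM sets_PiM_lborel)
  have sp: "space ?U = space (\<Pi>\<^sub>M i\<in>{..<p}. borel)" by (simp add: space_PiM)
  have "emeasure (uniform_sphere p) A = emeasure (distr ?U (\<Pi>\<^sub>M i\<in>{..<p}. borel) (vec_normalize p)) A"
    unfolding uniform_sphere_def unit_ball_def[symmetric]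
    using A unit_sphere_sets[of p] by (intro emeasure_restrict_space) auto
  also have "\<dots> = emeasure ?U (vec_normalize p -` A \<inter> space (\<Pi>\<^sub>M i\<in>{..<p}. borel))"
    using emeasure_distr[OF N A(2)] sp by simp
  also have "\<dots> = emeasure (\<Pi>\<^sub>M i\<in>{..<p}. lborel) (unit_ball p \<inter> (vec_normalize p -` A \<inter> space (\<Pi>\<^sub>M i\<in>{..<p}. borel))) /
    emeasure (\<Pi>\<^sub>M i\<in>{..<p}. lborel) (unit_ball p)"
    using unit_ball_sets[of p] measurable_sets[OF vec_normalize_measurable A(2)]
    by (intro emeasure_uniform_measure) (auto simp: sets_PiM_lborel)
  finally show ?thesis .
qed

lemma vec_normalize_in_sphere:
  assumes "i < p" "x i \<noteq> 0"
  shows "vec_normalize p x \<in> unit_sphere p"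
proof -
  have "L2_set x {..<p} \<noteq> 0"
    using assms by (auto simp: L2_set_eq_0_iff)
  moreover have "L2_set x {..<p} \<ge> 0" by simp
  ultimately have pos: "L2_set x {..<p} > 0" by linarith
  have "L2_set (\<lambda>i. x i * (1 / L2_set x {..<p})) {..<p} = L2_set x {..<p} * (1 / L2_set x {..<p})"
    using pos by (intro L2_set_left_distrib[symmetric]) auto
  also have "\<dots> = 1" using pos by simp
  finally have "L2_set (\<lambda>i. x i / L2_set x {..<p}) {..<p} = 1" by simp
  moreover have "L2_set (vec_normalize p x) {..<p} = L2_set (\<lambda>i. x i / L2_set x {..<p}) {..<p}"
    by (intro L2_set_cong) (auto simp: vec_normalize_def)
  ultimately show ?thesis
    by (auto simp: unit_sphere_def vec_normalize_def)
qed

text \<open>A point of the ball with \<open>x i\<close> nonzero normalises to a point of the sphere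
  with the same property, and almost every point is of this kind. Hence the set in
  \<open>full\<close> has mass 1, which gives the second claim and, for coordinate 0, the lower
  bound on the total mass.\<close>

lemma
  assumes p: "p \<ge> 1"
  shows prob_space_uniform_sphere: "prob_space (uniform_sphere p)"
    and AE_uniform_sphere_nonzero: "i < p \<Longrightarrow> AE x in uniform_sphere p. x i \<noteq> 0"
proof -
  let ?\<Lambda> = "\<Pi>\<^sub>M i\<in>{..<p}. lborel :: real measure"
  have full: "emeasure (uniform_sphere p) {x \<in> unit_sphere p. x i \<noteq> 0} = 1"
    "{x \<in> unit_sphere p. x i \<noteq> 0} \<in> sets (uniform_sphere p)" if "i < p" for i
  proof -
    let ?A = "{x \<in> unit_sphere p. x i \<noteq> 0}"
    have [measurable]: "(\<lambda>x. x i) \<in> borel_measurable (\<Pi>\<^sub>M i\<in>{..<p}. borel :: real measure)"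
      using that by (intro measurable_component_singleton) simp
    have "{x \<in> space (\<Pi>\<^sub>M i\<in>{..<p}. borel). x i \<noteq> (0::real)} \<in> sets (\<Pi>\<^sub>M i\<in>{..<p}. borel)"
      by measurable
    then have A: "?A \<in> sets (\<Pi>\<^sub>M i\<in>{..<p}. borel)"
      using sets.Int[OF unit_sphere_sets[of p], of "{x \<in> space (\<Pi>\<^sub>M i\<in>{..<p}. borel). x i \<noteq> (0::real)}"]
      by (auto simp: unit_sphere_def space_PiM Int_def conj_ac)
    then have A': "?A \<in> sets (sphere_borel p)"
      using unit_sphere_sets[of p] by (auto simp: sphere_borel_def sets_restrict_space_iff)
    let ?N = "unit_ball p \<inter> (vec_normalize p -` ?A \<inter> space (\<Pi>\<^sub>M i\<in>{..<p}. borel))"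
    have "emeasure ?\<Lambda> ?N = emeasure ?\<Lambda> (unit_ball p)"
    proof (rule emeasure_eq_AE)
      have "x \<in> ?N \<longleftrightarrow> x \<in> unit_ball p" if "x i \<noteq> 0" "x \<in> space ?\<Lambda>" for x
        using that \<open>i < p\<close> vec_normalize_in_sphere[of i p x]
        by (auto simp: vec_normalize_def space_PiM L2_set_eq_0_iff)
      then show "AE x in ?\<Lambda>. x \<in> ?N \<longleftrightarrow> x \<in> unit_ball p"
        using AE_PiM_lborel_nonzero[of "{..<p}" i] AE_space[of ?\<Lambda>] that
        by (auto elim: eventually_elim2)
      show "?N \<in> sets ?\<Lambda>" "unit_ball p \<in> sets ?\<Lambda>"
        using unit_ball_sets[of p] measurable_sets[OF vec_normalize_measurable A]
        by (auto simp: sets_PiM_lborel)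
    qed
    then show "emeasure (uniform_sphere p) ?A = 1"
      using emeasure_unit_ball[OF p] by (simp add: emeasure_uniform_sphere[OF A'] ennreal_divide_self less_top[symmetric])
    show "?A \<in> sets (uniform_sphere p)"
      using A' by (simp add: sets_uniform_sphere)
  qed
  show ps: "prob_space (uniform_sphere p)"
  proof
    have "emeasure (uniform_sphere p) (unit_sphere p) \<le> 1"
    proof -
      have "unit_sphere p \<in> sets (sphere_borel p)"
        using unit_sphere_sets[of p] by (auto simp: sphere_borel_def sets_restrict_space_iff)
      then show ?thesis
        using emeasure_unit_ball[OF p] unit_ball_sets[of p]
        by (simp only: emeasure_uniform_sphere, intro divide_le_posI_ennreal)
           (auto simp: zero_less_iff_neq_zero sets_PiM_lborel intro!: emeasure_mono)
    qed
    moreover have "emeasure (uniform_sphere p) (unit_sphere p) \<ge> 1"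
    proof -
      have 0: "0 < p" using p by simp
      have "emeasure (uniform_sphere p) {x \<in> unit_sphere p. x 0 \<noteq> 0} \<le> emeasure (uniform_sphere p) (unit_sphere p)"
        using sets.top[of "uniform_sphere p"] by (intro emeasure_mono) (auto simp: space_uniform_sphere)
      then show ?thesis using full(1)[OF 0] by simp
    qed
    ultimately show "emeasure (uniform_sphere p) (space (uniform_sphere p)) = 1"
      by (simp add: space_uniform_sphere)
  qed
  show "AE x in uniform_sphere p. x i \<noteq> 0" if "i < p"
  proof -
    interpret prob_space "uniform_sphere p" by (rule ps)
    have "prob {x \<in> unit_sphere p. x i \<noteq> 0} = 1"
      using full(1)[OF that] by (simp add: measure_def)
    then show ?thesis
      using AE_prob_1 by fastforce
  qed
qed

text \<open>As \<open>F\<close> respects norms and normalisation, the cone over the preimage of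
  \<open>A\<close> is the preimage of the cone over \<open>A\<close>; the two cones have equal
  volume because \<open>F\<close> preserves Lebesgue measure.\<close>

lemma distr_uniform_sphere:
  assumes F: "F \<in> measurable (\<Pi>\<^sub>M i\<in>{..<p}. lborel) (\<Pi>\<^sub>M i\<in>{..<p}. lborel)"
    and inv: "distr (\<Pi>\<^sub>M i\<in>{..<p}. lborel) (\<Pi>\<^sub>M i\<in>{..<p}. lborel) F = (\<Pi>\<^sub>M i\<in>{..<p}. lborel)"
    and norm: "\<And>x. L2_set (F x) {..<p} = L2_set x {..<p}"
    and comm: "\<And>x. vec_normalize p (F x) = F (vec_normalize p x)"
  shows "F \<in> measurable (uniform_sphere p) (uniform_sphere p)"
    and "distr (uniform_sphere p) (uniform_sphere p) F = uniform_sphere p"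
proof -
  let ?\<Lambda> = "\<Pi>\<^sub>M i\<in>{..<p}. lborel :: real measure"
  have F': "F \<in> measurable (\<Pi>\<^sub>M i\<in>{..<p}. borel) (\<Pi>\<^sub>M i\<in>{..<p}. borel)"
    using F by (simp add: measurable_def space_PiM sets_PiM_lborel)
  have Fsp: "F x \<in> {..<p} \<rightarrow>\<^sub>E UNIV" if "x \<in> {..<p} \<rightarrow>\<^sub>E UNIV" for x
    using measurable_space[OF F, of x] that by (simp add: space_PiM)
  have "F \<in> measurable (sphere_borel p) (sphere_borel p)"
    unfolding sphere_borel_def
    using F' norm Fsp by (intro measurable_restrict_space3) (auto simp: unit_sphere_def)
  then show Fm: "F \<in> measurable (uniform_sphere p) (uniform_sphere p)"
    by (simp cong: measurable_cong_sets add: sets_uniform_sphere)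
  show "distr (uniform_sphere p) (uniform_sphere p) F = uniform_sphere p"
  proof (rule measure_eqI)
    fix A assume "A \<in> sets (distr (uniform_sphere p) (uniform_sphere p) F)"
    then have A: "A \<in> sets (uniform_sphere p)" by simp
    then have As: "A \<in> sets (sphere_borel p)" by (simp add: sets_uniform_sphere)
    let ?N = "\<lambda>A. unit_ball p \<inter> (vec_normalize p -` A \<inter> space (\<Pi>\<^sub>M i\<in>{..<p}. borel))"
    have A': "A \<subseteq> unit_sphere p" "A \<in> sets (\<Pi>\<^sub>M i\<in>{..<p}. borel)"
      using As unit_sphere_sets[of p] unfolding sphere_borel_def by (auto simp: sets_restrict_space_iff)
    have NA: "?N A \<in> sets ?\<Lambda>"
      using unit_ball_sets[of p] measurable_sets[OF vec_normalize_measurable A'(2)]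
      by (auto simp: sets_PiM_lborel)
    let ?B = "F -` A \<inter> space (uniform_sphere p)"
    have B: "?B \<in> sets (sphere_borel p)"
      using measurable_sets[OF Fm A] by (simp add: sets_uniform_sphere)
    have eq: "?N ?B = F -` (?N A) \<inter> space ?\<Lambda>"
    proof (intro set_eqI iffI)
      fix x assume x: "x \<in> ?N ?B"
      then have "F x \<in> {..<p} \<rightarrow>\<^sub>E UNIV" by (intro Fsp) (simp add: space_PiM)
      with x show "x \<in> F -` (?N A) \<inter> space ?\<Lambda>"
        by (simp add: unit_ball_def norm comm space_PiM)
    next
      fix x assume x: "x \<in> F -` (?N A) \<inter> space ?\<Lambda>"
      then have *: "F (vec_normalize p x) \<in> A" by (simp add: comm)
      \<comment> \<open>Norm preservation carries norm 1 back from the image to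
        \<open>vec_normalize p x\<close>, so the origin needs no separate case.\<close>
      then have "L2_set (vec_normalize p x) {..<p} = 1"
        using A'(1) norm[of "vec_normalize p x"] by (auto simp: unit_sphere_def)
      then have "vec_normalize p x \<in> unit_sphere p"
        by (simp add: unit_sphere_def vec_normalize_def)
      with x * show "x \<in> ?N ?B"
        by (simp add: unit_ball_def norm comm space_PiM space_uniform_sphere)
    qed
    have "emeasure ?\<Lambda> (?N ?B) = emeasure (distr ?\<Lambda> ?\<Lambda> F) (?N A)"
      using emeasure_distr[OF F NA] eq by simp
    then have "emeasure (uniform_sphere p) ?B = emeasure (uniform_sphere p) A"
      using inv by (simp add: emeasure_uniform_sphere As B)
    then show "emeasure (distr (uniform_sphere p) (uniform_sphere p) F) A = emeasure (uniform_sphere p) A"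
      by (simp add: emeasure_distr[OF Fm A])
  qed simp
qed

subsection \<open>Measures on the sphere invariant under coordinate flips\<close>

definition flip :: "nat \<Rightarrow> (nat \<Rightarrow> real) \<Rightarrow> nat \<Rightarrow> real" where
  "flip i x = x(i := - x i)"

locale sphere_measure = prob_space \<mu> for \<mu> :: "(nat \<Rightarrow> real) measure" +
  fixes p :: nat
  assumes sets_\<mu>: "sets \<mu> = sets (sphere_borel p)"
begin

lemma space_\<mu>: "space \<mu> = unit_sphere p"
  using sets_eq_imp_space_eq[OF sets_\<mu>]
  by (auto simp: sphere_borel_def space_restrict_space unit_sphere_def space_PiM)

text \<open>For \<open>p = 0\<close> the sphere is empty, an empty sum of squares being 0, and
  carries no probability measure.\<close>

lemma p_pos: "p > 0"
proof (rule ccontr)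
  assume "\<not> p > 0"
  then have "space \<mu> = {}" by (auto simp: space_\<mu> unit_sphere_def)
  with not_empty show False by simp
qed

lemma sum_squares: "x \<in> space \<mu> \<Longrightarrow> (\<Sum>i<p. (x i)\<^sup>2) = 1"
  by (simp add: space_\<mu> unit_sphere_def L2_set_def)

lemma bdd_coord:
  assumes "i < p" shows "bdd_mble \<mu> (\<lambda>x. x i)"
proof (rule bdd_mbleI[where B=1])
  show "(\<lambda>x. x i) \<in> borel_measurable \<mu>"
    using assms measurable_restrict_space1[OF measurable_component_singleton[of i "{..<p}" "\<lambda>_. borel"], of "unit_sphere p"]
    by (simp cong: measurable_cong_sets add: sets_\<mu> sphere_borel_def)
  fix x assume "x \<in> space \<mu>"
  then have "(x i)\<^sup>2 \<le> 1"
    using sum_squares member_le_sum[of i "{..<p}" "\<lambda>i. (x i)\<^sup>2"] assms by auto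
  then show "\<bar>x i\<bar> \<le> 1" by (simp add: abs_square_le_1)
qed

end

locale flip_invariant_sphere_measure = sphere_measure +
  assumes flip_measurable: "i < p \<Longrightarrow> flip i \<in> measurable \<mu> \<mu>"
    and distr_flip: "i < p \<Longrightarrow> distr \<mu> \<mu> (flip i) = \<mu>"
begin

text \<open>The change of variables \<open>flip i\<close> makes the integral equal to its own
  negative.\<close>

lemma integral_odd:
  assumes i: "i < p" and f: "f \<in> borel_measurable \<mu>" and odd: "\<And>x. f (flip i x) = - f x"
  shows "(\<integral>x. f x \<partial>\<mu>) = (0::real)"
proof -
  have "(\<integral>x. f x \<partial>\<mu>) = (\<integral>x. f x \<partial>distr \<mu> \<mu> (flip i))"
    by (simp add: distr_flip i)
  also have "\<dots> = - (\<integral>x. f x \<partial>\<mu>)"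
    by (subst integral_distr[OF flip_measurable[OF i] f]) (simp add: odd)
  finally show ?thesis by simp
qed

end

subsection \<open>Fourth moments of the uniform distribution\<close>

lemma distr_PiM_lborel_flip:
  assumes "i < p"
  shows "flip i \<in> measurable (\<Pi>\<^sub>M i\<in>{..<p}. lborel) (\<Pi>\<^sub>M i\<in>{..<p}. lborel)"
    and "distr (\<Pi>\<^sub>M i\<in>{..<p}. lborel) (\<Pi>\<^sub>M i\<in>{..<p}. lborel) (flip i) = (\<Pi>\<^sub>M i\<in>{..<p}. lborel)"
proof -
  have "flip i = (\<lambda>x. x(i := 0 + (- 1) * x i))"
    by (auto simp: flip_def fun_eq_iff)
  then show "flip i \<in> measurable (\<Pi>\<^sub>M i\<in>{..<p}. lborel) (\<Pi>\<^sub>M i\<in>{..<p}. lborel)"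
    and "distr (\<Pi>\<^sub>M i\<in>{..<p}. lborel) (\<Pi>\<^sub>M i\<in>{..<p}. lborel) (flip i) = (\<Pi>\<^sub>M i\<in>{..<p}. lborel)"
    using distr_PiM_lborel_affine_update[of "{..<p}" i "- 1" "\<lambda>_. 0"] assms by simp_all
qed

text \<open>The factor 1 keeps the form of the affine updates, so that their invariance lemma
  applies directly.\<close>

definition shear :: "nat \<Rightarrow> nat \<Rightarrow> real \<Rightarrow> (nat \<Rightarrow> real) \<Rightarrow> nat \<Rightarrow> real" where
  "shear i j c x = x(i := c * x j + 1 * x i)"

lemma distr_PiM_lborel_shear:
  assumes "i < p" "j < p" "i \<noteq> j"
  shows "shear i j c \<in> measurable (\<Pi>\<^sub>M i\<in>{..<p}. lborel) (\<Pi>\<^sub>M i\<in>{..<p}. lborel)"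
    and "distr (\<Pi>\<^sub>M i\<in>{..<p}. lborel) (\<Pi>\<^sub>M i\<in>{..<p}. lborel) (shear i j c) = (\<Pi>\<^sub>M i\<in>{..<p}. lborel)"
proof -
  have eq: "shear i j c = (\<lambda>x. x(i := c * x j + 1 * x i))"
    by (simp add: shear_def[abs_def])
  have meas: "(\<lambda>x. c * x j) \<in> borel_measurable (\<Pi>\<^sub>M i\<in>{..<p}. lborel)"
    using assms measurable_component_singleton[of j "{..<p}" "\<lambda>_. lborel :: real measure"] by simp
  show "shear i j c \<in> measurable (\<Pi>\<^sub>M i\<in>{..<p}. lborel) (\<Pi>\<^sub>M i\<in>{..<p}. lborel)"
    unfolding eq using assms by (intro distr_PiM_lborel_affine_update(1) meas) auto
  show "distr (\<Pi>\<^sub>M i\<in>{..<p}. lborel) (\<Pi>\<^sub>M i\<in>{..<p}. lborel) (shear i j c) = (\<Pi>\<^sub>M i\<in>{..<p}. lborel)"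
    unfolding eq using assms by (intro distr_PiM_lborel_affine_update(2) meas) auto
qed

text \<open>
  The rotation with cosine \<open>3 / 5\<close> and sine \<open>4 / 5\<close> is a product of three rational shears, and shears preserve
  Lebesgue measure by Fubini.
\<close>

definition rotate345 :: "nat \<Rightarrow> nat \<Rightarrow> (nat \<Rightarrow> real) \<Rightarrow> nat \<Rightarrow> real" where
  "rotate345 i j x = x(i := 3 / 5 * x i - 4 / 5 * x j, j := 4 / 5 * x i + 3 / 5 * x j)"

text \<open>A rotation by t factors into shears with coefficients \<open>- tan (t / 2)\<close>,
  \<open>sin t\<close>, \<open>- tan (t / 2)\<close>; cosine \<open>3 / 5\<close> and sine
  \<open>4 / 5\<close> give \<open>tan (t / 2) = 1 / 2\<close>.\<close>

lemma rotate345_eq_shears: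
  "i \<noteq> j \<Longrightarrow> rotate345 i j = shear i j (- 1 / 2) \<circ> (shear j i (4 / 5) \<circ> shear i j (- 1 / 2))"
  by (auto simp: fun_eq_iff rotate345_def shear_def field_simps)

lemma distr_PiM_lborel_rotate345:
  assumes "i < p" "j < p" "i \<noteq> j"
  shows "rotate345 i j \<in> measurable (\<Pi>\<^sub>M i\<in>{..<p}. lborel) (\<Pi>\<^sub>M i\<in>{..<p}. lborel)"
    and "distr (\<Pi>\<^sub>M i\<in>{..<p}. lborel) (\<Pi>\<^sub>M i\<in>{..<p}. lborel) (rotate345 i j) = (\<Pi>\<^sub>M i\<in>{..<p}. lborel)"
proof -
  let ?L = "\<Pi>\<^sub>M i\<in>{..<p}. lborel :: real measure"
  note ij = distr_PiM_lborel_shear[OF assms, of "- 1 / 2"]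
  note ji = distr_PiM_lborel_shear[OF assms(2,1) assms(3)[symmetric], of "4 / 5"]
  note comp = measurable_comp[OF ij(1) ji(1)]
  show "rotate345 i j \<in> measurable ?L ?L"
    unfolding rotate345_eq_shears[OF assms(3)] by (rule measurable_comp[OF comp ij(1)])
  have "distr ?L ?L (rotate345 i j) = distr (distr (distr ?L ?L (shear i j (- 1 / 2))) ?L (shear j i (4 / 5))) ?L (shear i j (- 1 / 2))"
    unfolding rotate345_eq_shears[OF assms(3)] distr_distr[OF ji(1) ij(1)] distr_distr[OF ij(1) comp] ..
  then show "distr ?L ?L (rotate345 i j) = ?L"
    by (simp only: ij ji)
qed

lemma L2_set_flip: "L2_set (flip i x) {..<p} = L2_set x {..<p}"
  unfolding L2_set_def by (intro arg_cong[of _ _ sqrt] sum.cong) (auto simp: flip_def)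

lemma L2_set_rotate345:
  assumes "i < p" "j < p" "i \<noteq> j"
  shows "L2_set (rotate345 i j x) {..<p} = L2_set x {..<p}"
proof -
  have P: "{..<p} = insert i (insert j ({..<p} - {i, j}))" using assms by auto
  have "(\<Sum>k\<in>{..<p} - {i, j}. (rotate345 i j x k)\<^sup>2) = (\<Sum>k\<in>{..<p} - {i, j}. (x k)\<^sup>2)"
    by (intro sum.cong) (auto simp: rotate345_def)
  moreover have "(rotate345 i j x i)\<^sup>2 + (rotate345 i j x j)\<^sup>2 = (x i)\<^sup>2 + (x j)\<^sup>2"
    using assms(3) by (simp add: rotate345_def power2_eq_square field_simps)
  ultimately have "(\<Sum>k\<in>insert i (insert j ({..<p} - {i, j})). (rotate345 i j x k)\<^sup>2)
     = (\<Sum>k\<in>insert i (insert j ({..<p} - {i, j})). (x k)\<^sup>2)"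
    using assms(3) by simp
  then show ?thesis unfolding L2_set_def P[symmetric] by simp
qed

lemma flip_invariant_uniform_sphere:
  assumes p: "p \<ge> 1"
  shows "flip_invariant_sphere_measure (uniform_sphere p) p"
proof -
  interpret prob_space "uniform_sphere p" by (rule prob_space_uniform_sphere[OF p])
  have comm: "vec_normalize p (flip i x) = flip i (vec_normalize p x)" if "i < p" for i x
    using that by (auto simp: vec_normalize_def L2_set_flip fun_eq_iff) (auto simp: flip_def vec_normalize_def)
  show ?thesis
    by unfold_locales
       (auto simp: sets_uniform_sphere intro!: distr_uniform_sphere distr_PiM_lborel_flip L2_set_flip comm)
qed

text \<open>Invariance under this one rotation already forces
  \<open>m i i = m j j = 3 * m i j\<close> for distinct \<open>i\<close> and \<open>j\<close>, as
  for Gaussian coordinates. The square of the sphere equation is a sum of \<open>p ^ 2\<close> such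
  moments, each at least \<open>m 0 0 / 3\<close>, with total integral 1; this bounds
  \<open>m 0 0\<close>.\<close>

lemma fourth_moments_uniform_sphere:
  assumes p: "p \<ge> 1" and i: "i < p" and j: "j < p"
  shows "(\<integral>x. (x i)\<^sup>2 * (x j)\<^sup>2 \<partial>uniform_sphere p) \<le> 3 / real p ^ 2"
proof -
  interpret flip_invariant_sphere_measure "uniform_sphere p" p
    by (rule flip_invariant_uniform_sphere[OF p])
  define m where "m i j = (\<integral>x. (x i)\<^sup>2 * (x j)\<^sup>2 \<partial>uniform_sphere p)" for i j
  have rot: "(\<integral>x. f (rotate345 i j x) \<partial>uniform_sphere p) = (\<integral>x. f x \<partial>uniform_sphere p)"
    if ij: "i < p" "j < p" "i \<noteq> j" and f: "bdd_mble (uniform_sphere p) f" for i j f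
  proof -
    have comm: "vec_normalize p (rotate345 i j x) = rotate345 i j (vec_normalize p x)" for x
      unfolding vec_normalize_def L2_set_rotate345[OF ij]
      using ij by (auto simp: rotate345_def fun_eq_iff add_divide_distrib diff_divide_distrib)
    note F = distr_uniform_sphere[OF distr_PiM_lborel_rotate345[OF ij] L2_set_rotate345[OF ij] comm]
    show ?thesis
      using integral_distr[OF F(1) bdd_mble_measurable[OF f]] by (simp add: F(2))
  qed
  \<comment> \<open>The coefficients are \<open>3 ^ 4\<close>, \<open>6 * 3 ^ 2 * 4 ^ 2\<close>,
    \<open>4 ^ 4\<close> and \<open>5 ^ 4\<close>, from the fourth powers of the two rotated
    coordinates. Subtracting the equations gives \<open>m i i = m j j\<close>, and then either one
    gives \<open>m i j = m i i / 3\<close>.\<close>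
  have key: "81 * m i i + 864 * m i j + 256 * m j j = 625 * m i i \<and> 256 * m i i + 864 * m i j + 81 * m j j = 625 * m j j"
    if ij: "i < p" "j < p" "i \<noteq> j" for i j
  proof -
    have expand: "(\<integral>x. (c * x i + d * x j) ^ 4 \<partial>uniform_sphere p)
      = c ^ 4 * m i i + 6 * c\<^sup>2 * d\<^sup>2 * m i j + d ^ 4 * m j j" for c d :: real
    proof -
      \<comment> \<open>These are the terms of the binomial expansion that change sign under
        \<open>flip i\<close>.\<close>
      let ?O = "\<lambda>x::nat \<Rightarrow> real. 4 * c ^ 3 * d * (x i ^ 3 * x j) + 4 * c * d ^ 3 * (x i * x j ^ 3)"
      have odd: "(\<integral>x. ?O x \<partial>uniform_sphere p) = 0"
        using ij by (intro integral_odd[of i] bdd_mble_measurable bdd_mble_intros bdd_coord) (auto simp: flip_def)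
      have int: "integrable (uniform_sphere p) (\<lambda>x. (x k)\<^sup>2 * (x l)\<^sup>2)" "integrable (uniform_sphere p) ?O"
        if "k < p" "l < p" for k l
        using that ij by (intro bdd_mble_integrable bdd_mble_intros bdd_coord; simp)+
      have "(\<integral>x. (c * x i + d * x j) ^ 4 \<partial>uniform_sphere p)
        = (\<integral>x. (c ^ 4 * ((x i)\<^sup>2 * (x i)\<^sup>2) + 6 * c\<^sup>2 * d\<^sup>2 * ((x i)\<^sup>2 * (x j)\<^sup>2) + d ^ 4 * ((x j)\<^sup>2 * (x j)\<^sup>2)) + ?O x \<partial>uniform_sphere p)"
        by (intro Bochner_Integration.integral_cong refl)
           (simp add: power4_eq_xxxx power3_eq_cube power2_eq_square algebra_simps)
      also have "\<dots> = (\<integral>x. c ^ 4 * ((x i)\<^sup>2 * (x i)\<^sup>2) + 6 * c\<^sup>2 * d\<^sup>2 * ((x i)\<^sup>2 * (x j)\<^sup>2) + d ^ 4 * ((x j)\<^sup>2 * (x j)\<^sup>2) \<partial>uniform_sphere p) + (\<integral>x. ?O x \<partial>uniform_sphere p)"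
        using ij by (intro Bochner_Integration.integral_add int Bochner_Integration.integrable_add integrable_mult_right) auto
      also have "\<dots> = c ^ 4 * m i i + 6 * c\<^sup>2 * d\<^sup>2 * m i j + d ^ 4 * m j j"
        unfolding odd using ij by (simp add: int m_def del: power_add_numeral)
      finally show ?thesis .
    qed
    have b: "bdd_mble (uniform_sphere p) (\<lambda>x. x k ^ 4)" if "k < p" for k
      by (intro bdd_mble_intros bdd_coord that)
    have m4: "(\<integral>x. x k ^ 4 \<partial>uniform_sphere p) = m k k" for k
      by (simp add: m_def flip: power_add)
    have "m i i = (\<integral>x. (3 / 5 * x i + (- 4 / 5) * x j) ^ 4 \<partial>uniform_sphere p)"
      using rot[OF ij b[OF ij(1)]] ij by (simp add: m4 rotate345_def)
    moreover have "m j j = (\<integral>x. (4 / 5 * x i + 3 / 5 * x j) ^ 4 \<partial>uniform_sphere p)"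
      using rot[OF ij b[OF ij(2)]] ij by (simp add: m4 rotate345_def)
    ultimately show ?thesis
      unfolding expand by (simp add: power4_eq_xxxx power2_eq_square field_simps)
  qed
  have m_diag: "m k k = m 0 0" if "k < p" for k
    using key[of k 0] that p by (cases "k = 0") auto
  have m_off: "m k l = m 0 0 / 3" if "k < p" "l < p" "k \<noteq> l" for k l
    using key[OF that] m_diag[OF that(1)] m_diag[OF that(2)] by simp
  have "1 = (\<integral>x. (\<Sum>k<p. \<Sum>l<p. (x k)\<^sup>2 * (x l)\<^sup>2) \<partial>uniform_sphere p)"
  proof -
    have "(\<Sum>k<p. \<Sum>l<p. (x k)\<^sup>2 * (x l)\<^sup>2) = 1" if "x \<in> space (uniform_sphere p)" for x
      using sum_squares[OF that] by (simp flip: sum_product)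
    then have "(\<integral>x. (\<Sum>k<p. \<Sum>l<p. (x k)\<^sup>2 * (x l)\<^sup>2) \<partial>uniform_sphere p) = (\<integral>x. 1 \<partial>uniform_sphere p)"
      by (intro Bochner_Integration.integral_cong) auto
    then show ?thesis by (simp add: prob_space)
  qed
  also have "\<dots> = (\<Sum>k<p. \<integral>x. (\<Sum>l<p. (x k)\<^sup>2 * (x l)\<^sup>2) \<partial>uniform_sphere p)"
    by (intro Bochner_Integration.integral_sum bdd_mble_integrable bdd_mble_intros bdd_coord) auto
  also have "\<dots> = (\<Sum>k<p. \<Sum>l<p. m k l)"
    unfolding m_def by (intro sum.cong refl Bochner_Integration.integral_sum bdd_mble_integrable bdd_mble_intros bdd_coord) auto
  also have "\<dots> \<ge> (\<Sum>k<p. \<Sum>l<p. m 0 0 / 3)"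
  proof (intro sum_mono)
    fix k l assume "k \<in> {..<p}" "l \<in> {..<p}"
    moreover have "m 0 0 \<ge> 0" by (simp add: m_def)
    ultimately show "m 0 0 / 3 \<le> m k l" using m_diag[of k] m_off[of k l] by (cases "k = l") auto
  qed
  finally have "real p ^ 2 * m 0 0 \<le> 3"
    by (simp add: power2_eq_square)
  then have "m 0 0 \<le> 3 / real p ^ 2"
    using p by (simp add: pos_le_divide_eq mult.commute)
  moreover have "m i j \<le> m 0 0"
  proof -
    have "m 0 0 \<ge> 0" by (simp add: m_def)
    then show ?thesis using m_diag[OF i] m_off[OF i j] by (cases "i = j") auto
  qed
  ultimately show ?thesis by (simp add: m_def)
qed

text \<open>Collects the facts about the uniform distribution on which the rest of the argument
  relies; its construction as a cone measure does not enter again.\<close>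

locale isotropic_sphere_measure = flip_invariant_sphere_measure +
  assumes AE_nonzero: "i < p \<Longrightarrow> AE x in \<mu>. x i \<noteq> 0"
    and moment4: "i < p \<Longrightarrow> j < p \<Longrightarrow> (\<integral>x. (x i)\<^sup>2 * (x j)\<^sup>2 \<partial>\<mu>) \<le> 3 / real p ^ 2"

lemma isotropic_uniform_sphere:
  assumes p: "p \<ge> 1"
  shows "isotropic_sphere_measure (uniform_sphere p) p"
  using flip_invariant_uniform_sphere[OF p] AE_uniform_sphere_nonzero[OF p] fourth_moments_uniform_sphere[OF p]
  by (simp add: isotropic_sphere_measure_def isotropic_sphere_measure_axioms_def)

subsection \<open>Elementary inequalities\<close>

text \<open>Converts a bound on a second moment into one on the absolute first moment; the best
  \<open>c\<close> is the root of the second moment.\<close>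

lemma abs_le_AM_GM: "c > 0 \<Longrightarrow> \<bar>u\<bar> \<le> c / 2 + u\<^sup>2 / (2 * c)" for u c :: real
proof -
  assume c: "c > 0"
  have "0 \<le> (\<bar>u\<bar> - c)\<^sup>2" by simp
  then have "2 * c * \<bar>u\<bar> \<le> c\<^sup>2 + u\<^sup>2" by (simp add: power2_eq_square algebra_simps)
  then have "\<bar>u\<bar> \<le> (c\<^sup>2 + u\<^sup>2) / (2 * c)" using c by (simp add: pos_le_divide_eq mult.commute)
  also have "\<dots> = c / 2 + u\<^sup>2 / (2 * c)" using c by (simp add: power2_eq_square field_simps)
  finally show ?thesis .
qed

text \<open>Bounds an absolute first moment from below by a lower bound on the second moment and an
  upper bound on the fourth.\<close>

lemma abs_ge_square_minus_fourth: "\<bar>u\<bar> \<ge> u\<^sup>2 - u ^ 4" for u :: real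
proof (cases "\<bar>u\<bar> \<le> 1")
  case True
  then have "\<bar>u\<bar> * \<bar>u\<bar> \<le> \<bar>u\<bar>" by (intro mult_left_le) auto
  moreover have "u\<^sup>2 = \<bar>u\<bar> * \<bar>u\<bar>" by (simp add: power2_eq_square)
  moreover have "0 \<le> u ^ 4" by simp
  ultimately show ?thesis by linarith
next
  case False
  then have "\<bar>u\<bar> ^ 2 \<le> \<bar>u\<bar> ^ 4" by (intro power_increasing) auto
  then have "u\<^sup>2 \<le> u ^ 4" by simp
  then show ?thesis by linarith
qed

lemma sgn_square_le_1: "(sgn x)\<^sup>2 \<le> (1::real)"
  by (simp add: sgn_if)

text \<open>From \<open>exp (- x) \<le> 1 / (1 + x)\<close> and
  \<open>(1 + x) * (1 - x + x\<^sup>2) = 1 + x ^ 3\<close>.\<close>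

lemma exp_minus_le_quadratic: "exp (- x) \<le> 1 - x + x\<^sup>2" if "x \<ge> 0" for x :: real
proof -
  have "1 \<le> 1 + x ^ 3" using that by simp
  also have "\<dots> = (1 + x) * (1 - x + x\<^sup>2)" by (simp add: power2_eq_square power3_eq_cube algebra_simps)
  finally have "1 / (1 + x) \<le> 1 - x + x\<^sup>2" using that by (simp add: pos_divide_le_eq mult.commute)
  moreover have "exp (- x) \<le> 1 / (1 + x)"
    unfolding exp_minus inverse_eq_divide
    using that exp_ge_add_one_self[of x] by (intro divide_left_mono mult_pos_pos) auto
  ultimately show ?thesis by linarith
qed

text \<open>Both powers are bounded by exponentials, and these by quadratics whose linear terms
  cancel in the mean. Nonnegativity is recorded so that the mean can later be raised to the power
  \<open>p\<close>.\<close>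

lemma mean_power_pm_le:
  fixes b :: real
  assumes b: "0 \<le> b" "real n * b \<le> 1"
  shows "((1 + b) ^ n + (1 - b) ^ n) / 2 \<le> 1 + (real n * b)\<^sup>2"
    and "0 \<le> ((1 + b) ^ n + (1 - b) ^ n) / 2"
proof -
  have "((1 + b) ^ n + (1 - b) ^ n) / 2 \<le> 1 + (real n * b)\<^sup>2 \<and> 0 \<le> ((1 + b) ^ n + (1 - b) ^ n) / 2"
  proof (cases "n = 0")
    case False
    \<comment> \<open>Since \<open>n \<ge> 1\<close>, the bound on \<open>real n * b\<close> also
      bounds \<open>b\<close>, so that \<open>1 - b\<close> is nonnegative and its powers are
      monotone.\<close>
    then have "1 * b \<le> real n * b" using b(1) by (intro mult_right_mono) auto
    then have b1: "b \<le> 1" using b(2) by linarith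
    then have "(1 - b) ^ n \<le> exp (- b) ^ n"
      using exp_ge_add_one_self[of "- b"] by (intro power_mono) auto
    also have "exp (- b) ^ n = exp (- (real n * b))"
      by (simp flip: exp_of_nat_mult)
    also have "\<dots> \<le> 1 - real n * b + (real n * b)\<^sup>2"
      using b by (intro exp_minus_le_quadratic) simp
    finally have minus: "(1 - b) ^ n \<le> 1 - real n * b + (real n * b)\<^sup>2" .
    have "(1 + b) ^ n \<le> exp b ^ n"
      using b(1) by (intro power_mono) auto
    also have "exp b ^ n = exp (real n * b)"
      by (simp flip: exp_of_nat_mult)
    also have "\<dots> \<le> 1 + real n * b + (real n * b)\<^sup>2"
      using b by (intro exp_bound) auto
    finally have plus: "(1 + b) ^ n \<le> 1 + real n * b + (real n * b)\<^sup>2" .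
    have "(1 + b) ^ n + (1 - b) ^ n \<le> 2 * (1 + (real n * b)\<^sup>2)"
      using add_mono[OF plus minus] by simp
    moreover have "(1 + b) ^ n \<ge> 0" "(1 - b) ^ n \<ge> 0" using b(1) b1 by simp_all
    ultimately show ?thesis by simp
  qed simp
  then show "((1 + b) ^ n + (1 - b) ^ n) / 2 \<le> 1 + (real n * b)\<^sup>2"
    and "0 \<le> ((1 + b) ^ n + (1 - b) ^ n) / 2" by auto
qed

subsection \<open>Products of densities and sign vectors\<close>

text \<open>The integral of the product density over a box factorises, and a product measure is
  determined by its values on boxes.\<close>

lemma PiM_density:
  fixes f :: "'a \<Rightarrow> ennreal"
  assumes I: "finite I" and f [measurable]: "f \<in> borel_measurable M"
    and M: "sigma_finite_measure M" "sigma_finite_measure (density M f)"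
  shows "(\<Pi>\<^sub>M i\<in>I. density M f) = density (\<Pi>\<^sub>M i\<in>I. M) (\<lambda>x. \<Prod>i\<in>I. f (x i))"
proof -
  interpret M: product_sigma_finite "\<lambda>_::'b. M" using M by unfold_locales (auto simp: sigma_finite_measure_def)
  interpret D: product_sigma_finite "\<lambda>_::'b. density M f" using M by (simp add: product_sigma_finite_def)
  show ?thesis
  proof (rule D.PiM_eqI[OF I, symmetric])
    show "sets (density (\<Pi>\<^sub>M i\<in>I. M) (\<lambda>x. \<Prod>i\<in>I. f (x i))) = sets (\<Pi>\<^sub>M i\<in>I. density M f)"
      by (simp cong: sets_PiM_cong)
    fix A assume "\<And>i. i \<in> I \<Longrightarrow> A i \<in> sets (density M f)"
    then have A: "\<And>i. i \<in> I \<Longrightarrow> A i \<in> sets M" by simp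
    have PA: "Pi\<^sub>E I A \<in> sets (\<Pi>\<^sub>M i\<in>I. M)" using I A by (intro sets_PiM_I_finite) auto
    have "emeasure (density (\<Pi>\<^sub>M i\<in>I. M) (\<lambda>x. \<Prod>i\<in>I. f (x i))) (Pi\<^sub>E I A)
      = (\<integral>\<^sup>+x. (\<Prod>i\<in>I. f (x i)) * indicator (Pi\<^sub>E I A) x \<partial>(\<Pi>\<^sub>M i\<in>I. M))"
      using PA I by (intro emeasure_density) auto
    also have "\<dots> = (\<integral>\<^sup>+x. (\<Prod>i\<in>I. f (x i) * indicator (A i) (x i)) \<partial>(\<Pi>\<^sub>M i\<in>I. M))"
    proof (intro nn_integral_cong)
      fix x assume "x \<in> space (\<Pi>\<^sub>M i\<in>I. M)"
      then have "indicator (Pi\<^sub>E I A) x = (\<Prod>i\<in>I. indicator (A i) (x i) :: ennreal)"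
        using I by (auto simp: indicator_def PiE_iff space_PiM prod_zero_iff)
      then show "(\<Prod>i\<in>I. f (x i)) * indicator (Pi\<^sub>E I A) x = (\<Prod>i\<in>I. f (x i) * indicator (A i) (x i))"
        by (simp add: prod.distrib)
    qed
    also have "\<dots> = (\<Prod>i\<in>I. \<integral>\<^sup>+x. f x * indicator (A i) x \<partial>M)"
      using I A by (intro M.product_nn_integral_prod) auto
    also have "\<dots> = (\<Prod>i\<in>I. emeasure (density M f) (A i))"
      using A by (intro prod.cong refl emeasure_density[symmetric]) auto
    finally show "emeasure (density (\<Pi>\<^sub>M i\<in>I. M) (\<lambda>x. \<Prod>i\<in>I. f (x i))) (Pi\<^sub>E I A) = (\<Prod>i\<in>I. emeasure (density M f) (A i))" .
  qed
qed

definition sign_vectors :: "nat \<Rightarrow> (nat \<Rightarrow> real) set" where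
  "sign_vectors p = {..<p} \<rightarrow>\<^sub>E {-1, 1}"

lemma finite_sign_vectors: "finite (sign_vectors p)"
  by (simp add: sign_vectors_def finite_PiE)

lemma card_sign_vectors: "card (sign_vectors p) = 2 ^ p"
proof -
  have "card {-1, 1 :: real} = 2" by simp
  then show ?thesis by (simp only: sign_vectors_def card_PiE finite_lessThan prod_constant card_lessThan)
qed

lemma sign_vectors_cases: "s \<in> sign_vectors p \<Longrightarrow> i < p \<Longrightarrow> s i = 1 \<or> s i = - 1"
  by (auto simp: sign_vectors_def PiE_iff)

text \<open>The coordinates of \<open>t\<close> range independently, so the sum of products is a
  product of sums; the sign \<open>s i\<close> merely swaps the two summands of its factor.\<close>

lemma sum_sign_vectors_prod:
  fixes b :: real
  assumes "s \<in> sign_vectors p"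
  shows "(\<Sum>t\<in>sign_vectors p. (\<Prod>i<p. 1 + b * s i * t i) ^ n) = ((1 + b) ^ n + (1 - b) ^ n) ^ p"
proof -
  have "(\<Sum>t\<in>sign_vectors p. (\<Prod>i<p. 1 + b * s i * t i) ^ n) = (\<Prod>i<p. \<Sum>y\<in>{-1, 1}. (1 + b * s i * y) ^ n)"
    using prod_sum_PiE[of "{..<p}" "\<lambda>_. {-1, 1}" "\<lambda>i y. (1 + b * s i * y) ^ n"]
    by (simp only: sign_vectors_def prod_power_distrib finite_lessThan finite_insert finite.emptyI simp_thms)
  also have "\<dots> = (\<Prod>i<p. (1 + b) ^ n + (1 - b) ^ n)"
  proof (intro prod.cong refl)
    fix i assume "i \<in> {..<p}"
    then have "s i = 1 \<or> s i = - 1" using sign_vectors_cases[OF assms] by simp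
    then show "(\<Sum>y\<in>{-1, 1}. (1 + b * s i * y) ^ n) = (1 + b) ^ n + (1 - b) ^ n"
      by (elim disjE) simp_all
  qed
  finally show ?thesis by simp
qed

subsection \<open>Moments of the inner product of two independent points\<close>

context isotropic_sphere_measure
begin

sublocale pair: pair_prob_space \<mu> \<mu> ..

abbreviation "\<mu>2 \<equiv> \<mu> \<Otimes>\<^sub>M \<mu>"

text \<open>Two symmetries of the pair are used: \<open>flip1 i\<close> reverses the sign of the
  \<open>i\<close>-th product of coordinates only, whereas \<open>flip2 i\<close> preserves all of
  these products and hence the inner product.\<close>

definition flip1 :: "nat \<Rightarrow> (nat \<Rightarrow> real) \<times> (nat \<Rightarrow> real) \<Rightarrow> (nat \<Rightarrow> real) \<times> (nat \<Rightarrow> real)" where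
  "flip1 i = (\<lambda>(x, y). (flip i x, y))"

definition flip2 :: "nat \<Rightarrow> (nat \<Rightarrow> real) \<times> (nat \<Rightarrow> real) \<Rightarrow> (nat \<Rightarrow> real) \<times> (nat \<Rightarrow> real)" where
  "flip2 i = (\<lambda>(x, y). (flip i x, flip i y))"

lemma flip1_measurable: "i < p \<Longrightarrow> flip1 i \<in> measurable \<mu>2 \<mu>2"
  unfolding flip1_def using flip_measurable[of i] by measurable

lemma flip2_measurable: "i < p \<Longrightarrow> flip2 i \<in> measurable \<mu>2 \<mu>2"
  unfolding flip2_def using flip_measurable[of i] by measurable

lemma distr_flip1: "i < p \<Longrightarrow> distr \<mu>2 \<mu>2 (flip1 i) = \<mu>2"
  unfolding flip1_def
  using pair_measure_distr[of "flip i" \<mu> \<mu> "\<lambda>x. x" \<mu> \<mu>] flip_measurable[of i] distr_flip[of i] sigma_finite_measure_axioms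
  by (simp add: distr_id)

lemma distr_flip2: "i < p \<Longrightarrow> distr \<mu>2 \<mu>2 (flip2 i) = \<mu>2"
  unfolding flip2_def
  using pair_measure_distr[of "flip i" \<mu> \<mu> "flip i" \<mu> \<mu>] flip_measurable[of i] distr_flip[of i] sigma_finite_measure_axioms
  by simp

lemma integral_flip1:
  assumes i: "i < p" and f: "f \<in> borel_measurable \<mu>2"
  shows "(\<integral>z. f (flip1 i z) \<partial>\<mu>2) = (\<integral>z. (f z::real) \<partial>\<mu>2)"
  using integral_distr[OF flip1_measurable[OF i] f] by (simp add: distr_flip1 i)

lemma integral_flip2:
  assumes i: "i < p" and f: "f \<in> borel_measurable \<mu>2"
  shows "(\<integral>z. f (flip2 i z) \<partial>\<mu>2) = (\<integral>z. (f z::real) \<partial>\<mu>2)"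
  using integral_distr[OF flip2_measurable[OF i] f] by (simp add: distr_flip2 i)

lemma integral_odd1:
  assumes "i < p" "f \<in> borel_measurable \<mu>2" "\<And>z. f (flip1 i z) = - f z"
  shows "(\<integral>z. f z \<partial>\<mu>2) = (0::real)"
  using integral_flip1[OF assms(1,2)] assms(3) by simp

lemma integral_odd2:
  assumes "i < p" "f \<in> borel_measurable \<mu>2" "\<And>z. f (flip2 i z) = - f z"
  shows "(\<integral>z. f z \<partial>\<mu>2) = (0::real)"
  using integral_flip2[OF assms(1,2)] assms(3) by simp

definition coord_prod :: "nat \<Rightarrow> (nat \<Rightarrow> real) \<times> (nat \<Rightarrow> real) \<Rightarrow> real" where
  "coord_prod i z = fst z i * snd z i"

lemma coord_prod_flip1: "coord_prod j (flip1 i z) = (if j = i then - coord_prod j z else coord_prod j z)"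
  by (cases z) (simp add: coord_prod_def flip1_def flip_def)

lemma coord_prod_flip2: "coord_prod j (flip2 i z) = coord_prod j z"
  by (cases z) (simp add: coord_prod_def flip2_def flip_def)

lemma bdd_fst: "i < p \<Longrightarrow> bdd_mble \<mu>2 (\<lambda>z. fst z i)"
  by (rule bdd_mble_compose[OF bdd_coord measurable_fst])

lemma bdd_snd: "i < p \<Longrightarrow> bdd_mble \<mu>2 (\<lambda>z. snd z i)"
  by (rule bdd_mble_compose[OF bdd_coord measurable_snd])

lemma bdd_coord_prod: "i < p \<Longrightarrow> bdd_mble \<mu>2 (coord_prod i)"
  unfolding coord_prod_def[abs_def] by (intro bdd_mble_intros bdd_fst bdd_snd)

lemmas bdd_intros = bdd_mble_intros bdd_coord_prod

lemma bdd_integrable: "bdd_mble \<mu>2 f \<Longrightarrow> integrable \<mu>2 f"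
  by (rule pair.P.bdd_mble_integrable)

lemma integral_prod_fun:
  assumes "bdd_mble \<mu> f" "bdd_mble \<mu> g"
  shows "(\<integral>z. f (fst z) * g (snd z) \<partial>\<mu>2) = (\<integral>x. f x \<partial>\<mu>) * (\<integral>x. g x \<partial>\<mu>)"
proof -
  have "integrable \<mu>2 (\<lambda>z. f (fst z) * g (snd z))"
    using assms by (intro bdd_integrable bdd_mble_intros bdd_mble_compose[OF _ measurable_fst] bdd_mble_compose[OF _ measurable_snd])
  from pair.integral_fst'[OF this] show ?thesis by simp
qed

lemma coord_prod_moment4:
  assumes "i < p" "j < p"
  shows "(\<integral>z. (coord_prod i z)\<^sup>2 * (coord_prod j z)\<^sup>2 \<partial>\<mu>2) \<le> 9 / real p ^ 4"
proof -
  have "bdd_mble \<mu> (\<lambda>x. (x i)\<^sup>2 * (x j)\<^sup>2)"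
    by (intro bdd_mble_intros bdd_coord assms)
  from integral_prod_fun[OF this this]
  have "(\<integral>z. (coord_prod i z)\<^sup>2 * (coord_prod j z)\<^sup>2 \<partial>\<mu>2) = (\<integral>x. (x i)\<^sup>2 * (x j)\<^sup>2 \<partial>\<mu>) * (\<integral>x. (x i)\<^sup>2 * (x j)\<^sup>2 \<partial>\<mu>)"
    by (simp add: coord_prod_def power_mult_distrib mult_ac)
  also have "\<dots> \<le> (3 / real p ^ 2) * (3 / real p ^ 2)"
    using moment4[OF assms] by (intro mult_mono) auto
  also have "\<dots> = 9 / real p ^ 4"
    by (simp flip: power_add)
  finally show ?thesis .
qed

text \<open>Pythagoras with an even weight: the cross term is odd under the flip and integrates to
  zero. The moment bounds for sums over coordinates follow from this by adding one coordinate at a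
  time.\<close>

lemma integral_square_odd_add_even:
  assumes j: "j < p" and b: "bdd_mble \<mu>2 W" "bdd_mble \<mu>2 A" "bdd_mble \<mu>2 R"
    and W: "\<And>z. W (flip1 j z) = W z" and A: "\<And>z. A (flip1 j z) = - A z"
    and R: "\<And>z. R (flip1 j z) = R z"
  shows "(\<integral>z. W z * (A z + R z)\<^sup>2 \<partial>\<mu>2) = (\<integral>z. W z * (A z)\<^sup>2 \<partial>\<mu>2) + (\<integral>z. W z * (R z)\<^sup>2 \<partial>\<mu>2)"
proof -
  have odd: "(\<integral>z. 2 * (W z * A z * R z) \<partial>\<mu>2) = 0"
    by (rule integral_odd1[OF j]) (auto intro!: bdd_mble_measurable bdd_intros b simp: W A R)
  have "(\<integral>z. W z * (A z + R z)\<^sup>2 \<partial>\<mu>2)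
      = (\<integral>z. (W z * (A z)\<^sup>2 + 2 * (W z * A z * R z)) + W z * (R z)\<^sup>2 \<partial>\<mu>2)"
    by (intro Bochner_Integration.integral_cong) (auto simp: power2_sum algebra_simps)
  also have "\<dots> = (\<integral>z. W z * (A z)\<^sup>2 \<partial>\<mu>2) + (\<integral>z. 2 * (W z * A z * R z) \<partial>\<mu>2)
      + (\<integral>z. W z * (R z)\<^sup>2 \<partial>\<mu>2)"
    by (subst Bochner_Integration.integral_add; (intro bdd_integrable bdd_intros b)?)+ simp
  finally show ?thesis using odd by simp
qed

lemma sum_coord_prod_flip1: "j \<notin> J \<Longrightarrow> (\<Sum>i\<in>J. f (coord_prod i (flip1 j z))) = (\<Sum>i\<in>J. f (coord_prod i z))"
  by (intro sum.cong) (auto simp: coord_prod_flip1)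

text \<open>Each new product of coordinates is odd under its own flip, hence orthogonal to the sum
  of the earlier ones.\<close>

lemma second_moment_sum_coord_prod:
  assumes "J \<subseteq> {..<p}"
  shows "(\<integral>z. (\<Sum>j\<in>J. coord_prod j z)\<^sup>2 \<partial>\<mu>2) = (\<Sum>j\<in>J. \<integral>z. (coord_prod j z)\<^sup>2 \<partial>\<mu>2)"
proof -
  have "finite J" using assms finite_subset by blast
  then show ?thesis using assms
  proof (induction J)
    case (insert j J)
    then have j: "j < p" and J: "i \<in> J \<Longrightarrow> i < p" for i by auto
    have "(\<integral>z. 1 * (coord_prod j z + (\<Sum>i\<in>J. coord_prod i z))\<^sup>2 \<partial>\<mu>2) = (\<integral>z. 1 * (coord_prod j z)\<^sup>2 \<partial>\<mu>2) + (\<integral>z. 1 * (\<Sum>i\<in>J. coord_prod i z)\<^sup>2 \<partial>\<mu>2)"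
      using insert.hyps sum_coord_prod_flip1[of j J "\<lambda>x. x"]
      by (intro integral_square_odd_add_even[OF j] bdd_intros j J) (auto simp: coord_prod_flip1[of j])
    then show ?case
      using insert by simp
  qed simp
qed

text \<open>Same orthogonality; the weight is a square, so it is even under the flip of
  \<open>j\<close> also when \<open>j = i\<close>.\<close>

lemma mixed_moment_sum_coord_prod:
  assumes "i < p" "J \<subseteq> {..<p}"
  shows "(\<integral>z. (coord_prod i z)\<^sup>2 * (\<Sum>j\<in>J. coord_prod j z)\<^sup>2 \<partial>\<mu>2) \<le> real (card J) * (9 / real p ^ 4)"
proof -
  have "finite J" using assms finite_subset by blast
  then show ?thesis using assms(2)
  proof (induction J)
    case (insert j J)
    then have j: "j < p" and J: "i \<in> J \<Longrightarrow> i < p" for i by auto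
    have "(\<integral>z. (coord_prod i z)\<^sup>2 * (coord_prod j z + (\<Sum>k\<in>J. coord_prod k z))\<^sup>2 \<partial>\<mu>2)
        = (\<integral>z. (coord_prod i z)\<^sup>2 * (coord_prod j z)\<^sup>2 \<partial>\<mu>2) + (\<integral>z. (coord_prod i z)\<^sup>2 * (\<Sum>k\<in>J. coord_prod k z)\<^sup>2 \<partial>\<mu>2)"
      using insert.hyps sum_coord_prod_flip1[of j J "\<lambda>x. x"]
      by (intro integral_square_odd_add_even[OF j] bdd_intros j J assms(1)) (auto simp: coord_prod_flip1[of j] coord_prod_flip1[of i])
    also have "\<dots> \<le> 9 / real p ^ 4 + real (card J) * (9 / real p ^ 4)"
      using insert coord_prod_moment4[OF assms(1) j] by (intro add_mono) auto
    finally show ?case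
      using insert by (simp add: distrib_right add_divide_distrib)
  qed simp
qed

text \<open>Signed squares are odd as well, so their sum again has orthogonal terms, each with
  second moment at most \<open>9 / real p ^ 4\<close>.\<close>

lemma second_moment_sum_signed_square:
  assumes "J \<subseteq> {..<p}"
  shows "(\<integral>z. (\<Sum>j\<in>J. coord_prod j z * \<bar>coord_prod j z\<bar>)\<^sup>2 \<partial>\<mu>2) \<le> real (card J) * (9 / real p ^ 4)"
proof -
  have "finite J" using assms finite_subset by blast
  then show ?thesis using assms
  proof (induction J)
    case (insert j J)
    then have j: "j < p" and J: "i \<in> J \<Longrightarrow> i < p" for i by auto
    have "(\<integral>z. 1 * (coord_prod j z * \<bar>coord_prod j z\<bar> + (\<Sum>k\<in>J. coord_prod k z * \<bar>coord_prod k z\<bar>))\<^sup>2 \<partial>\<mu>2)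
        = (\<integral>z. 1 * (coord_prod j z * \<bar>coord_prod j z\<bar>)\<^sup>2 \<partial>\<mu>2) + (\<integral>z. 1 * (\<Sum>k\<in>J. coord_prod k z * \<bar>coord_prod k z\<bar>)\<^sup>2 \<partial>\<mu>2)"
      using insert.hyps sum_coord_prod_flip1[of j J "\<lambda>x. x * \<bar>x\<bar>"]
      by (intro integral_square_odd_add_even[OF j] bdd_intros j J) (auto simp: coord_prod_flip1[of j])
    also have "(\<lambda>z. 1 * (coord_prod j z * \<bar>coord_prod j z\<bar>)\<^sup>2) = (\<lambda>z. (coord_prod j z)\<^sup>2 * (coord_prod j z)\<^sup>2)"
      by (simp add: power_mult_distrib)
    also have "(\<integral>z. (coord_prod j z)\<^sup>2 * (coord_prod j z)\<^sup>2 \<partial>\<mu>2) + (\<integral>z. 1 * (\<Sum>k\<in>J. coord_prod k z * \<bar>coord_prod k z\<bar>)\<^sup>2 \<partial>\<mu>2)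
        \<le> 9 / real p ^ 4 + real (card J) * (9 / real p ^ 4)"
      using insert coord_prod_moment4[OF j j] by (intro add_mono) auto
    finally show ?case
      using insert by (simp add: distrib_right add_divide_distrib)
  qed simp
qed

text \<open>In the fourth power of the sum extended by coordinate \<open>j\<close>, the odd powers
  of the new product vanish. The remaining increment is at most \<open>9 / real p ^ 4\<close> plus 6
  times \<open>9 / real p ^ 3\<close>, hence at most \<open>63 / real p ^ 3\<close>.\<close>

lemma fourth_moment_sum_coord_prod:
  assumes "J \<subseteq> {..<p}"
  shows "(\<integral>z. (\<Sum>j\<in>J. coord_prod j z) ^ 4 \<partial>\<mu>2) \<le> real (card J) * (63 / real p ^ 3)"
proof -
  have "finite J" using assms finite_subset by blast
  then show ?thesis using assms
  proof (induction J)
    case (insert j J)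
    then have j: "j < p" and J: "i \<in> J \<Longrightarrow> i < p" and J': "J \<subseteq> {..<p}" for i by auto
    define R where "R = (\<lambda>z. \<Sum>i\<in>J. coord_prod i z)"
    have bR: "bdd_mble \<mu>2 R" unfolding R_def by (intro bdd_intros J)
    have flip_R: "R (flip1 j z) = R z" for z
      using insert.hyps sum_coord_prod_flip1[of j J "\<lambda>x. x"] by (simp add: R_def)
    let ?O = "\<lambda>z. 4 * (coord_prod j z ^ 3 * R z) + 4 * (coord_prod j z * R z ^ 3)"
    have odd: "(\<integral>z. ?O z \<partial>\<mu>2) = 0"
      by (rule integral_odd1[OF j]) (auto intro!: bdd_mble_measurable bdd_intros j bR simp: coord_prod_flip1 flip_R)
    have "(\<integral>z. (coord_prod j z + R z) ^ 4 \<partial>\<mu>2)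
        = (\<integral>z. ((coord_prod j z)\<^sup>2 * (coord_prod j z)\<^sup>2 + ?O z) + (6 * ((coord_prod j z)\<^sup>2 * (R z)\<^sup>2) + R z ^ 4) \<partial>\<mu>2)"
      by (intro Bochner_Integration.integral_cong refl) (simp add: power4_eq_xxxx power3_eq_cube power2_eq_square algebra_simps)
    also have "\<dots> = (\<integral>z. (coord_prod j z)\<^sup>2 * (coord_prod j z)\<^sup>2 + ?O z \<partial>\<mu>2) + (\<integral>z. 6 * ((coord_prod j z)\<^sup>2 * (R z)\<^sup>2) + R z ^ 4 \<partial>\<mu>2)"
      by (intro Bochner_Integration.integral_add bdd_integrable bdd_intros j bR)
    also have "(\<integral>z. (coord_prod j z)\<^sup>2 * (coord_prod j z)\<^sup>2 + ?O z \<partial>\<mu>2) = (\<integral>z. (coord_prod j z)\<^sup>2 * (coord_prod j z)\<^sup>2 \<partial>\<mu>2) + (\<integral>z. ?O z \<partial>\<mu>2)"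
      by (intro Bochner_Integration.integral_add bdd_integrable bdd_intros j bR)
    also have "(\<integral>z. 6 * ((coord_prod j z)\<^sup>2 * (R z)\<^sup>2) + R z ^ 4 \<partial>\<mu>2) = (\<integral>z. 6 * ((coord_prod j z)\<^sup>2 * (R z)\<^sup>2) \<partial>\<mu>2) + (\<integral>z. R z ^ 4 \<partial>\<mu>2)"
      by (intro Bochner_Integration.integral_add bdd_integrable bdd_intros j bR)
    also have "(\<integral>z. 6 * ((coord_prod j z)\<^sup>2 * (R z)\<^sup>2) \<partial>\<mu>2) = 6 * (\<integral>z. (coord_prod j z)\<^sup>2 * (R z)\<^sup>2 \<partial>\<mu>2)"
      by simp
    also have "((\<integral>z. (coord_prod j z)\<^sup>2 * (coord_prod j z)\<^sup>2 \<partial>\<mu>2) + (\<integral>z. ?O z \<partial>\<mu>2)) + (6 * (\<integral>z. (coord_prod j z)\<^sup>2 * (R z)\<^sup>2 \<partial>\<mu>2) + (\<integral>z. R z ^ 4 \<partial>\<mu>2))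
      \<le> (9 / real p ^ 4 + 0) + (6 * (real p * (9 / real p ^ 4)) + real (card J) * (63 / real p ^ 3))"
    proof (intro add_mono mult_left_mono)
      have "(\<integral>z. (coord_prod j z)\<^sup>2 * (R z)\<^sup>2 \<partial>\<mu>2) \<le> real (card J) * (9 / real p ^ 4)"
        unfolding R_def by (rule mixed_moment_sum_coord_prod[OF j J'])
      also have "\<dots> \<le> real p * (9 / real p ^ 4)"
        using card_mono[OF _ J'] by (intro mult_right_mono) auto
      finally show "(\<integral>z. (coord_prod j z)\<^sup>2 * (R z)\<^sup>2 \<partial>\<mu>2) \<le> real p * (9 / real p ^ 4)" .
    qed (use insert odd coord_prod_moment4[OF j j] in \<open>auto simp: R_def\<close>)
    also have "\<dots> \<le> (9 / real p ^ 3) + (6 * (9 / real p ^ 3) + real (card J) * (63 / real p ^ 3))"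
    proof (intro add_mono mult_left_mono order_refl)
      show "9 / real p ^ 4 + 0 \<le> 9 / real p ^ 3"
        using p_pos by (auto intro!: divide_left_mono power_increasing)
      show "real p * (9 / real p ^ 4) \<le> 9 / real p ^ 3"
        using p_pos by (simp add: power4_eq_xxxx power3_eq_cube)
    qed simp_all
    finally show ?case
      using insert by (simp add: distrib_right add_divide_distrib R_def)
  qed simp
qed

section \<open>The event of a nonpositive inner product\<close>

definition dotp :: "(nat \<Rightarrow> real) \<times> (nat \<Rightarrow> real) \<Rightarrow> real" where
  "dotp z = (\<Sum>i<p. coord_prod i z)"

definition nonpos_ind :: "(nat \<Rightarrow> real) \<times> (nat \<Rightarrow> real) \<Rightarrow> real" where
  "nonpos_ind z = (if dotp z \<le> 0 then 1 else 0)"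

lemma bdd_dotp: "bdd_mble \<mu>2 dotp"
  unfolding dotp_def[abs_def] by (intro bdd_intros) simp

lemma bdd_nonpos_ind: "bdd_mble \<mu>2 nonpos_ind"
  using bdd_mble_measurable[OF bdd_dotp] by (intro bdd_mbleI[where B=1]) (auto simp: nonpos_ind_def[abs_def])

lemma dotp_flip1: "i < p \<Longrightarrow> dotp (flip1 i z) = dotp z - 2 * coord_prod i z"
  using sum_coord_prod_flip1[of i "{..<p} - {i}" "\<lambda>x. x" z]
  by (simp add: dotp_def sum.remove[of "{..<p}" i] coord_prod_flip1)

lemma nonpos_ind_flip2: "nonpos_ind (flip2 i z) = nonpos_ind z"
  by (simp add: nonpos_ind_def dotp_def coord_prod_flip2)

text \<open>Averaging with the flipped integral leaves the difference of the two indicators times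
  \<open>h\<close>. If the \<open>i\<close>-th product is nonnegative, reversing its sign can only
  lower the inner product, so this difference has the opposite sign to \<open>h\<close>; the other
  case is symmetric.\<close>

lemma integral_nonpos_ind_odd:
  assumes i: "i < p" and b: "bdd_mble \<mu>2 (\<lambda>z. h (coord_prod i z))"
    and odd: "\<And>x. h (- x) = - h x" and nonneg: "\<And>x. x \<ge> 0 \<Longrightarrow> h x \<ge> 0"
  shows "(\<integral>z. nonpos_ind z * h (coord_prod i z) \<partial>\<mu>2) \<le> 0"
proof -
  have bG': "bdd_mble \<mu>2 (\<lambda>z. nonpos_ind (flip1 i z))"
    by (rule bdd_mble_compose[OF bdd_nonpos_ind flip1_measurable[OF i]])
  have "(\<integral>z. nonpos_ind z * h (coord_prod i z) \<partial>\<mu>2) = (\<integral>z. nonpos_ind (flip1 i z) * h (coord_prod i (flip1 i z)) \<partial>\<mu>2)"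
    by (intro integral_flip1[OF i, symmetric] bdd_mble_measurable bdd_intros bdd_nonpos_ind b)
  also have "\<dots> = - (\<integral>z. nonpos_ind (flip1 i z) * h (coord_prod i z) \<partial>\<mu>2)"
    by (simp add: coord_prod_flip1 odd)
  finally have "2 * (\<integral>z. nonpos_ind z * h (coord_prod i z) \<partial>\<mu>2) = (\<integral>z. nonpos_ind z * h (coord_prod i z) \<partial>\<mu>2) - (\<integral>z. nonpos_ind (flip1 i z) * h (coord_prod i z) \<partial>\<mu>2)"
    by simp
  also have "\<dots> = (\<integral>z. nonpos_ind z * h (coord_prod i z) - nonpos_ind (flip1 i z) * h (coord_prod i z) \<partial>\<mu>2)"
    by (intro Bochner_Integration.integral_diff[symmetric] bdd_integrable bdd_intros bdd_nonpos_ind b bG')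
  also have "\<dots> \<le> (\<integral>z. 0 \<partial>\<mu>2)"
  proof (intro integral_mono bdd_integrable bdd_intros bdd_nonpos_ind b bG')
    fix z
    have "coord_prod i z \<ge> 0 \<or> - coord_prod i z \<ge> 0" by linarith
    then show "nonpos_ind z * h (coord_prod i z) - nonpos_ind (flip1 i z) * h (coord_prod i z) \<le> 0"
      using nonneg[of "coord_prod i z"] nonneg[of "- coord_prod i z"] odd[of "coord_prod i z"] by (auto simp: nonpos_ind_def dotp_flip1[OF i])
  qed
  finally show ?thesis by simp
qed

text \<open>By orthogonality and independence this is the sum of squares of the coordinate second
  moments. These add up to 1, so it is smallest when all equal \<open>1 / real p\<close>.\<close>

lemma second_moment_dotp: "(\<integral>z. (dotp z)\<^sup>2 \<partial>\<mu>2) \<ge> 1 / real p"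
proof -
  let ?m = "\<lambda>i. \<integral>x. (x i)\<^sup>2 \<partial>\<mu>"
  have "(\<Sum>i<p. ?m i) = (\<integral>x. (\<Sum>i<p. (x i)\<^sup>2) \<partial>\<mu>)"
    by (intro Bochner_Integration.integral_sum[symmetric] bdd_mble_integrable bdd_mble_intros bdd_coord) simp
  also have "\<dots> = (\<integral>x. 1 \<partial>\<mu>)"
    using sum_squares by (intro Bochner_Integration.integral_cong) auto
  finally have m: "(\<Sum>i<p. ?m i) = 1" by (simp add: prob_space)
  have "(\<integral>z. (dotp z)\<^sup>2 \<partial>\<mu>2) = (\<Sum>i<p. \<integral>z. (coord_prod i z)\<^sup>2 \<partial>\<mu>2)"
    unfolding dotp_def by (intro second_moment_sum_coord_prod) simp
  also have "\<dots> = (\<Sum>i<p. (?m i)\<^sup>2)"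
  proof (intro sum.cong refl)
    fix i assume "i \<in> {..<p}"
    then have "bdd_mble \<mu> (\<lambda>x. (x i)\<^sup>2)" by (intro bdd_mble_intros bdd_coord) simp
    from integral_prod_fun[OF this this] show "(\<integral>z. (coord_prod i z)\<^sup>2 \<partial>\<mu>2) = (?m i)\<^sup>2"
      by (simp add: coord_prod_def power_mult_distrib power2_eq_square[of "?m i"])
  qed
  finally have eq: "(\<integral>z. (dotp z)\<^sup>2 \<partial>\<mu>2) = (\<Sum>i<p. (?m i)\<^sup>2)" .
  have "0 \<le> (\<Sum>i<p. (?m i - 1 / real p)\<^sup>2)" by (simp add: sum_nonneg)
  also have "\<dots> = (\<Sum>i<p. (?m i)\<^sup>2 + 1 / (real p)\<^sup>2 - (2 / real p) * ?m i)"
    by (simp add: power2_diff power_divide)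
  also have "\<dots> = (\<Sum>i<p. (?m i)\<^sup>2) + 1 / real p - 2 / real p"
  proof -
    have "(\<Sum>i<p. (2 / real p) * ?m i) = 2 / real p"
      by (subst sum_distrib_left[symmetric]) (simp add: m)
    moreover have "(\<Sum>i<p. 1 / (real p)\<^sup>2) = 1 / real p"
      using p_pos by (simp add: power2_eq_square)
    ultimately show ?thesis by (simp only: sum.distrib sum_subtractf)
  qed
  finally show ?thesis using eq by (simp add: diff_divide_distrib)
qed

lemma first_moment_dotp: "(\<integral>z. dotp z \<partial>\<mu>2) = 0"
proof -
  have "(\<integral>z. dotp z \<partial>\<mu>2) = (\<Sum>i<p. \<integral>z. coord_prod i z \<partial>\<mu>2)"
    unfolding dotp_def by (intro Bochner_Integration.integral_sum bdd_integrable bdd_coord_prod) simp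
  also have "\<dots> = (\<Sum>i<p. 0)"
    by (intro sum.cong refl integral_odd1 bdd_mble_measurable bdd_coord_prod) (auto simp: coord_prod_flip1)
  finally show ?thesis by simp
qed

lemma abs_moment_dotp: "(\<integral>z. \<bar>dotp z\<bar> \<partial>\<mu>2) \<ge> 3 / (64 * sqrt (real p))"
proof -
  \<comment> \<open>Scaling by \<open>r\<close> brings the inner product to constant order. The
    second moment then contributes at least \<open>1 / 144\<close> and the fourth costs at most
    \<open>7 / 16\<close> of that.\<close>
  define r where "r = sqrt (real p) / 12"
  have r: "r > 0" "r\<^sup>2 = real p / 144" "r ^ 4 = (real p / 144)\<^sup>2"
    using p_pos by (auto simp: r_def power_divide power4_eq_xxxx power2_eq_square)
  have "9 / 16 / 144 \<le> r\<^sup>2 * (1 / real p) - r ^ 4 * (real p * (63 / real p ^ 3))"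
    unfolding r using p_pos by (simp add: field_simps power2_eq_square power3_eq_cube)
  also have "\<dots> \<le> r\<^sup>2 * (\<integral>z. (dotp z)\<^sup>2 \<partial>\<mu>2) - r ^ 4 * (\<integral>z. (dotp z) ^ 4 \<partial>\<mu>2)"
    using second_moment_dotp fourth_moment_sum_coord_prod[of "{..<p}"] r(1)
    by (intro diff_mono mult_left_mono) (auto simp: dotp_def)
  also have "\<dots> = (\<integral>z. r\<^sup>2 * (dotp z)\<^sup>2 - r ^ 4 * (dotp z) ^ 4 \<partial>\<mu>2)"
    by (subst Bochner_Integration.integral_diff; (intro bdd_integrable bdd_intros bdd_dotp)?) simp
  also have "\<dots> \<le> (\<integral>z. r * \<bar>dotp z\<bar> \<partial>\<mu>2)"
  proof (intro integral_mono bdd_integrable bdd_intros bdd_dotp)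
    fix z show "r\<^sup>2 * (dotp z)\<^sup>2 - r ^ 4 * (dotp z) ^ 4 \<le> r * \<bar>dotp z\<bar>"
      using abs_ge_square_minus_fourth[of "r * dotp z"] r(1) by (simp add: power_mult_distrib abs_mult)
  qed
  also have "\<dots> = r * (\<integral>z. \<bar>dotp z\<bar> \<partial>\<mu>2)" by simp
  finally have "3 / 768 \<le> r * (\<integral>z. \<bar>dotp z\<bar> \<partial>\<mu>2)" by simp
  then have "3 / 64 \<le> sqrt (real p) * (\<integral>z. \<bar>dotp z\<bar> \<partial>\<mu>2)" by (simp add: r_def)
  then show ?thesis using p_pos by (simp add: field_simps)
qed

text \<open>The factor \<open>real p / 256\<close> is the \<open>k\<close> of the tangent-type
  comparison below, where this quantity must stay below a fraction of the mean absolute inner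
  product.\<close>

lemma abs_moment_sum_signed_square:
  "(real p / 256) * (\<integral>z. \<bar>\<Sum>i<p. coord_prod i z * \<bar>coord_prod i z\<bar>\<bar> \<partial>\<mu>2) \<le> 3 / (256 * sqrt (real p))"
proof -
  let ?V = "\<lambda>z. \<Sum>i<p. coord_prod i z * \<bar>coord_prod i z\<bar>"
  have bV: "bdd_mble \<mu>2 ?V" by (intro bdd_intros) auto
  \<comment> \<open>The square of \<open>c\<close> is the bound \<open>9 / real p ^ 3\<close> on the
    second moment, so the inequality of arithmetic and geometric means returns exactly
    \<open>c\<close>.\<close>
  define c where "c = 3 / (real p * sqrt (real p))"
  have c: "c > 0" using p_pos by (simp add: c_def)
  have "(\<integral>z. \<bar>?V z\<bar> \<partial>\<mu>2) \<le> (\<integral>z. c / 2 + (?V z)\<^sup>2 * (1 / (2 * c)) \<partial>\<mu>2)"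
    using abs_le_AM_GM[OF c] by (intro integral_mono bdd_integrable bdd_intros bV) auto
  also have "\<dots> = c / 2 + (\<integral>z. (?V z)\<^sup>2 \<partial>\<mu>2) * (1 / (2 * c))"
    by (subst Bochner_Integration.integral_add; (intro bdd_integrable bdd_intros bV)?) (simp add: pair.P.prob_space)
  also have "\<dots> \<le> c / 2 + (real p * (9 / real p ^ 4)) * (1 / (2 * c))"
    using second_moment_sum_signed_square[of "{..<p}"] c by (intro add_mono mult_right_mono) auto
  also have "\<dots> = c"
  proof -
    have "real p * (9 / real p ^ 4) = c\<^sup>2"
      using p_pos by (simp add: c_def power_divide power_mult_distrib power4_eq_xxxx power2_eq_square)
    then show ?thesis using c by (simp add: power2_eq_square)
  qed
  finally have "(real p / 256) * (\<integral>z. \<bar>?V z\<bar> \<partial>\<mu>2) \<le> (real p / 256) * c"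
    by (intro mult_left_mono) auto
  then show ?thesis using p_pos by (simp add: c_def)
qed

definition sign_sum :: "(nat \<Rightarrow> real) \<times> (nat \<Rightarrow> real) \<Rightarrow> real" where
  "sign_sum z = (\<Sum>i<p. sgn (coord_prod i z))"

lemma bdd_sign_sum: "bdd_mble \<mu>2 sign_sum"
  unfolding sign_sum_def[abs_def] by (intro bdd_intros) simp

text \<open>
  Since \<open>1 - u + u\<^sup>2 \<ge> 0\<close>, the odd function \<open>h x = sgn x - k x + k\<^sup>2 x \<bar>x\<bar>\<close> has the sign of \<open>x\<close>. This trades
  the sum of the signs for the inner product itself, whose typical size is controlled by moments.
  The constant in \<open>k = p / 256\<close> is small enough for the quadratic correction to be negligible.
\<close>

lemma integral_nonpos_ind_sign_sum: "(\<integral>z. nonpos_ind z * sign_sum z \<partial>\<mu>2) \<le> - (3 * sqrt (real p) / 65536)"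
proof -
  define k where "k = real p / 256"
  have k: "k > 0" using p_pos by (simp add: k_def)
  let ?V = "\<lambda>z. \<Sum>i<p. coord_prod i z * \<bar>coord_prod i z\<bar>"
  have bV: "bdd_mble \<mu>2 ?V" by (intro bdd_intros) auto
  define h where "h x = sgn x - k * x + k\<^sup>2 * (x * \<bar>x\<bar>)" for x
  have h_nonneg: "h x \<ge> 0" if "x \<ge> 0" for x
  proof (cases "x = 0")
    case False
    with that have "h x = (1 - k * x / 2)\<^sup>2 + 3 / 4 * (k * x)\<^sup>2"
      by (simp add: h_def power2_eq_square algebra_simps)
    then show ?thesis by simp
  qed (simp add: h_def)
  have bh: "bdd_mble \<mu>2 (\<lambda>z. h (coord_prod i z))" if "i < p" for i
    unfolding h_def by (intro bdd_intros that)
  have "(\<integral>z. nonpos_ind z * (sign_sum z - k * dotp z + k\<^sup>2 * ?V z) \<partial>\<mu>2) = (\<integral>z. (\<Sum>i<p. nonpos_ind z * h (coord_prod i z)) \<partial>\<mu>2)"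
    by (intro Bochner_Integration.integral_cong refl)
       (simp add: h_def sign_sum_def dotp_def sum.distrib sum_subtractf sum_distrib_left distrib_left right_diff_distrib)
  also have "\<dots> = (\<Sum>i<p. \<integral>z. nonpos_ind z * h (coord_prod i z) \<partial>\<mu>2)"
    by (intro Bochner_Integration.integral_sum bdd_integrable bdd_mble_mult bdd_nonpos_ind bh) simp
  also have "\<dots> \<le> 0"
  proof (rule sum_nonpos)
    fix i assume "i \<in> {..<p}"
    then show "(\<integral>z. nonpos_ind z * h (coord_prod i z) \<partial>\<mu>2) \<le> 0"
      by (intro integral_nonpos_ind_odd bh h_nonneg) (auto simp: h_def sgn_minus)
  qed
  finally have 1: "(\<integral>z. nonpos_ind z * (sign_sum z - k * dotp z + k\<^sup>2 * ?V z) \<partial>\<mu>2) \<le> 0" .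
  \<comment> \<open>As the inner product has mean zero, its integral over the event is minus half of
    its mean absolute value; this is the source of the negative sign.\<close>
  have GT: "nonpos_ind z * dotp z = (dotp z - \<bar>dotp z\<bar>) / 2" for z by (auto simp: nonpos_ind_def)
  have "(\<integral>z. nonpos_ind z * sign_sum z \<partial>\<mu>2) + (k / 2) * (\<integral>z. \<bar>dotp z\<bar> \<partial>\<mu>2) - k\<^sup>2 * (\<integral>z. \<bar>?V z\<bar> \<partial>\<mu>2)
     = (\<integral>z. nonpos_ind z * sign_sum z + (k / 2) * \<bar>dotp z\<bar> - k\<^sup>2 * \<bar>?V z\<bar> \<partial>\<mu>2)"
  proof -
    have "(\<integral>z. nonpos_ind z * sign_sum z + (k / 2) * \<bar>dotp z\<bar> - k\<^sup>2 * \<bar>?V z\<bar> \<partial>\<mu>2)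
        = (\<integral>z. nonpos_ind z * sign_sum z + (k / 2) * \<bar>dotp z\<bar> \<partial>\<mu>2) - (\<integral>z. k\<^sup>2 * \<bar>?V z\<bar> \<partial>\<mu>2)"
      by (intro Bochner_Integration.integral_diff bdd_integrable bdd_mble_add bdd_mble_mult bdd_mble_abs bdd_mble_const bdd_dotp bdd_sign_sum bdd_nonpos_ind bV)
    also have "(\<integral>z. nonpos_ind z * sign_sum z + (k / 2) * \<bar>dotp z\<bar> \<partial>\<mu>2) = (\<integral>z. nonpos_ind z * sign_sum z \<partial>\<mu>2) + (\<integral>z. (k / 2) * \<bar>dotp z\<bar> \<partial>\<mu>2)"
      by (intro Bochner_Integration.integral_add bdd_integrable bdd_mble_mult bdd_mble_abs bdd_mble_const bdd_dotp bdd_sign_sum bdd_nonpos_ind)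
    finally show ?thesis by simp
  qed
  also have "\<dots> \<le> (\<integral>z. nonpos_ind z * (sign_sum z - k * dotp z + k\<^sup>2 * ?V z) + (k / 2) * dotp z \<partial>\<mu>2)"
  proof (intro integral_mono bdd_integrable bdd_mble_add bdd_mble_diff bdd_mble_mult bdd_mble_abs bdd_mble_const bdd_dotp bdd_sign_sum bdd_nonpos_ind bV)
    fix z
    have "- \<bar>?V z\<bar> \<le> nonpos_ind z * ?V z"
    proof -
      have "- \<bar>v\<bar> \<le> g * v" if "g = 0 \<or> g = 1" for g v :: real
        using that by (auto simp: abs_if)
      then show ?thesis by (simp add: nonpos_ind_def)
    qed
    then have "k\<^sup>2 * (- \<bar>?V z\<bar>) \<le> k\<^sup>2 * (nonpos_ind z * ?V z)" by (intro mult_left_mono) auto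
    moreover have "nonpos_ind z * (sign_sum z - k * dotp z + k\<^sup>2 * ?V z) = nonpos_ind z * sign_sum z - k * (nonpos_ind z * dotp z) + k\<^sup>2 * (nonpos_ind z * ?V z)"
      by (simp add: algebra_simps)
    moreover have "k * (nonpos_ind z * dotp z) = k / 2 * dotp z - k / 2 * \<bar>dotp z\<bar>"
      unfolding GT by (simp add: field_simps)
    ultimately show "nonpos_ind z * sign_sum z + (k / 2) * \<bar>dotp z\<bar> - k\<^sup>2 * \<bar>?V z\<bar>
       \<le> nonpos_ind z * (sign_sum z - k * dotp z + k\<^sup>2 * ?V z) + (k / 2) * dotp z"
      by linarith
  qed
  also have "\<dots> = (\<integral>z. nonpos_ind z * (sign_sum z - k * dotp z + k\<^sup>2 * ?V z) \<partial>\<mu>2) + (k / 2) * (\<integral>z. dotp z \<partial>\<mu>2)"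
  proof -
    have "(\<integral>z. nonpos_ind z * (sign_sum z - k * dotp z + k\<^sup>2 * ?V z) + (k / 2) * dotp z \<partial>\<mu>2)
      = (\<integral>z. nonpos_ind z * (sign_sum z - k * dotp z + k\<^sup>2 * ?V z) \<partial>\<mu>2) + (\<integral>z. (k / 2) * dotp z \<partial>\<mu>2)"
      by (intro Bochner_Integration.integral_add bdd_integrable bdd_mble_add bdd_mble_diff bdd_mble_mult bdd_mble_const bdd_dotp bdd_sign_sum bdd_nonpos_ind bV)
    then show ?thesis by simp
  qed
  also have "\<dots> \<le> 0" using 1 first_moment_dotp by simp
  finally have "(\<integral>z. nonpos_ind z * sign_sum z \<partial>\<mu>2) \<le> k * (k * (\<integral>z. \<bar>?V z\<bar> \<partial>\<mu>2)) - (k / 2) * (\<integral>z. \<bar>dotp z\<bar> \<partial>\<mu>2)"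
    by (simp add: power2_eq_square)
  \<comment> \<open>The bound on the quadratic correction is exactly half of the bound on the gain,
    so half of the latter survives.\<close>
  also have "\<dots> \<le> k * (3 / (256 * sqrt (real p))) - (k / 2) * (3 / (64 * sqrt (real p)))"
    using abs_moment_sum_signed_square abs_moment_dotp k by (intro diff_mono mult_left_mono) (auto simp: k_def)
  also have "\<dots> = - (3 * (real p / sqrt (real p)) / 65536)"
    using p_pos by (simp add: k_def field_simps)
  also have "real p / sqrt (real p) = sqrt (real p)"
    by (simp add: real_div_sqrt)
  finally show ?thesis .
qed

subsection \<open>Expansion of the tilted product\<close>

text \<open>With \<open>b = a\<^sup>2\<close> this is what remains of the product of the tilts at
  two points once the terms linear in a single sign have integrated to zero.\<close>

definition sign_prod :: "real \<Rightarrow> nat set \<Rightarrow> (nat \<Rightarrow> real) \<times> (nat \<Rightarrow> real) \<Rightarrow> real" where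
  "sign_prod b J z = (\<Prod>i\<in>J. 1 + b * sgn (coord_prod i z))"

lemma bdd_sign_prod: "J \<subseteq> {..<p} \<Longrightarrow> bdd_mble \<mu>2 (sign_prod b J)"
  unfolding sign_prod_def[abs_def] by (intro bdd_intros) auto

lemma sign_prod_flip1: "j \<notin> J \<Longrightarrow> sign_prod b J (flip1 j z) = sign_prod b J z"
  unfolding sign_prod_def by (intro prod.cong) (auto simp: coord_prod_flip1)

text \<open>The added term is odd under the flip of \<open>j\<close>, hence orthogonal to
  \<open>R\<close>. Only an inequality results, because \<open>sgn\<close> vanishes at 0.\<close>

lemma integral_square_add_sgn:
  assumes j: "j < p" and b: "bdd_mble \<mu>2 A" "bdd_mble \<mu>2 R"
    and "\<And>z. A (flip1 j z) = A z" "\<And>z. R (flip1 j z) = R z"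
  shows "(\<integral>z. (R z + b * sgn (coord_prod j z) * A z)\<^sup>2 \<partial>\<mu>2) \<le> (\<integral>z. (R z)\<^sup>2 \<partial>\<mu>2) + b\<^sup>2 * (\<integral>z. (A z)\<^sup>2 \<partial>\<mu>2)"
proof -
  have "(\<integral>z. 1 * (b * sgn (coord_prod j z) * A z + R z)\<^sup>2 \<partial>\<mu>2)
    = (\<integral>z. 1 * (b * sgn (coord_prod j z) * A z)\<^sup>2 \<partial>\<mu>2) + (\<integral>z. 1 * (R z)\<^sup>2 \<partial>\<mu>2)"
    using assms by (intro integral_square_odd_add_even[OF j] bdd_intros) (auto simp: coord_prod_flip1 sgn_minus)
  moreover have "(\<integral>z. 1 * (b * sgn (coord_prod j z) * A z)\<^sup>2 \<partial>\<mu>2) \<le> (\<integral>z. b\<^sup>2 * (A z)\<^sup>2 \<partial>\<mu>2)"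
  proof (intro integral_mono bdd_integrable bdd_intros j b)
    fix z
    have "(sgn (coord_prod j z))\<^sup>2 * (b\<^sup>2 * (A z)\<^sup>2) \<le> 1 * (b\<^sup>2 * (A z)\<^sup>2)"
      by (intro mult_right_mono sgn_square_le_1) auto
    then show "1 * (b * sgn (coord_prod j z) * A z)\<^sup>2 \<le> b\<^sup>2 * (A z)\<^sup>2"
      by (simp add: power_mult_distrib mult_ac)
  qed
  ultimately show ?thesis by (simp add: add.commute)
qed

lemma second_moment_sign_prod:
  assumes "J \<subseteq> {..<p}"
  shows "(\<integral>z. (sign_prod b J z)\<^sup>2 \<partial>\<mu>2) \<le> (1 + b\<^sup>2) ^ card J"
proof -
  have "finite J" using assms finite_subset by blast
  then show ?thesis using assms
  proof (induction J)
    case (insert j J)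
    then have j: "j < p" and J: "J \<subseteq> {..<p}" by auto
    have "(\<integral>z. (sign_prod b (insert j J) z)\<^sup>2 \<partial>\<mu>2) = (\<integral>z. (sign_prod b J z + b * sgn (coord_prod j z) * sign_prod b J z)\<^sup>2 \<partial>\<mu>2)"
      using insert.hyps by (simp add: sign_prod_def distrib_right)
    also have "\<dots> \<le> (\<integral>z. (sign_prod b J z)\<^sup>2 \<partial>\<mu>2) + b\<^sup>2 * (\<integral>z. (sign_prod b J z)\<^sup>2 \<partial>\<mu>2)"
      using insert.hyps by (intro integral_square_add_sgn j bdd_sign_prod J sign_prod_flip1)
    also have "\<dots> = (1 + b\<^sup>2) * (\<integral>z. (sign_prod b J z)\<^sup>2 \<partial>\<mu>2)" by (simp add: distrib_right)
    also have "\<dots> \<le> (1 + b\<^sup>2) * (1 + b\<^sup>2) ^ card J"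
      using insert J by (intro mult_left_mono) auto
    finally show ?case using insert.hyps by simp
  qed (simp add: sign_prod_def pair.P.prob_space)
qed

lemma second_moment_sign_prod_le_3:
  assumes J: "J \<subseteq> {..<p}" and b: "b\<^sup>2 * real p \<le> 1"
  shows "(\<integral>z. (sign_prod b J z)\<^sup>2 \<partial>\<mu>2) \<le> 3"
proof -
  have "(\<integral>z. (sign_prod b J z)\<^sup>2 \<partial>\<mu>2) \<le> (1 + b\<^sup>2) ^ card J"
    by (rule second_moment_sign_prod[OF J])
  also have "\<dots> \<le> (1 + b\<^sup>2) ^ p"
    using card_mono[OF _ J] by (intro power_increasing) auto
  also have "\<dots> \<le> exp (b\<^sup>2) ^ p"
    by (intro power_mono) auto
  also have "\<dots> = exp (b\<^sup>2 * real p)"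
    by (simp add: exp_of_nat_mult mult.commute)
  also have "\<dots> \<le> exp 1" using b by simp
  also have "\<dots> \<le> 3" by (rule exp_le)
  finally show ?thesis .
qed

text \<open>Including coordinate \<open>j\<close> adds \<open>b * sgn (coord_prod j z)\<close> times
  the previous product. These increments are orthogonal, with second moment at most
  \<open>3 * b\<^sup>2\<close> each.\<close>

lemma second_moment_sign_prod_minus_1:
  assumes "J \<subseteq> {..<p}" and b: "b\<^sup>2 * real p \<le> 1"
  shows "(\<integral>z. (sign_prod b J z - 1)\<^sup>2 \<partial>\<mu>2) \<le> real (card J) * (b\<^sup>2 * 3)"
proof -
  have "finite J" using assms finite_subset by blast
  then show ?thesis using assms(1)
  proof (induction J)
    case (insert j J)
    then have j: "j < p" and J: "J \<subseteq> {..<p}" by auto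
    have "(\<integral>z. (sign_prod b (insert j J) z - 1)\<^sup>2 \<partial>\<mu>2) = (\<integral>z. ((sign_prod b J z - 1) + b * sgn (coord_prod j z) * sign_prod b J z)\<^sup>2 \<partial>\<mu>2)"
      using insert.hyps by (simp add: sign_prod_def distrib_right add.commute algebra_simps)
    also have "\<dots> \<le> (\<integral>z. (sign_prod b J z - 1)\<^sup>2 \<partial>\<mu>2) + b\<^sup>2 * (\<integral>z. (sign_prod b J z)\<^sup>2 \<partial>\<mu>2)"
      using insert.hyps by (intro integral_square_add_sgn j bdd_sign_prod J sign_prod_flip1 bdd_mble_diff bdd_mble_const) (auto simp: sign_prod_flip1)
    also have "\<dots> \<le> real (card J) * (b\<^sup>2 * 3) + b\<^sup>2 * 3"
      using insert J second_moment_sign_prod_le_3[OF J b] by (intro add_mono mult_left_mono) auto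
    finally show ?case using insert.hyps by (simp add: distrib_right)
  qed (simp add: sign_prod_def)
qed

text \<open>
  Adding the coordinate \<open>j\<close> changes the remainder by a term that is odd under the flip of \<open>j\<close>,
  hence orthogonal to what was there before.
\<close>

lemma second_moment_remainder:
  assumes "J \<subseteq> {..<p}" and b: "b\<^sup>2 * real p \<le> 1"
  shows "(\<integral>z. (sign_prod b J z - 1 - b * (\<Sum>i\<in>J. sgn (coord_prod i z)))\<^sup>2 \<partial>\<mu>2) \<le> real (card J) * (3 * b ^ 4 * real p)"
proof -
  have "finite J" using assms finite_subset by blast
  then show ?thesis using assms(1)
  proof (induction J)
    case (insert j J)
    then have j: "j < p" and J: "J \<subseteq> {..<p}" by auto
    let ?R = "\<lambda>J z. sign_prod b J z - 1 - b * (\<Sum>i\<in>J. sgn (coord_prod i z))"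
    have bR: "bdd_mble \<mu>2 (?R J)"
      using J by (intro bdd_intros bdd_sign_prod) auto
    have step: "?R (insert j J) z = ?R J z + b * sgn (coord_prod j z) * (sign_prod b J z - 1)" for z
      using insert.hyps by (simp add: sign_prod_def algebra_simps)
    have flip_R: "?R J (flip1 j z) = ?R J z" for z
      using insert.hyps sum_coord_prod_flip1[of j J sgn z] by (simp add: sign_prod_flip1)
    have "(\<integral>z. (?R (insert j J) z)\<^sup>2 \<partial>\<mu>2) = (\<integral>z. (?R J z + b * sgn (coord_prod j z) * (sign_prod b J z - 1))\<^sup>2 \<partial>\<mu>2)"
      by (simp only: step)
    also have "\<dots> \<le> (\<integral>z. (?R J z)\<^sup>2 \<partial>\<mu>2) + b\<^sup>2 * (\<integral>z. (sign_prod b J z - 1)\<^sup>2 \<partial>\<mu>2)"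
      using insert.hyps
      by (intro integral_square_add_sgn[OF j _ bR _ flip_R] bdd_mble_diff bdd_mble_const bdd_sign_prod J) (simp add: sign_prod_flip1)
    also have "\<dots> \<le> real (card J) * (3 * b ^ 4 * real p) + b\<^sup>2 * (real p * (b\<^sup>2 * 3))"
    proof (intro add_mono mult_left_mono)
      have "(\<integral>z. (sign_prod b J z - 1)\<^sup>2 \<partial>\<mu>2) \<le> real (card J) * (b\<^sup>2 * 3)"
        by (rule second_moment_sign_prod_minus_1[OF J b])
      also have "\<dots> \<le> real p * (b\<^sup>2 * 3)"
        using card_mono[OF _ J] by (intro mult_right_mono) auto
      finally show "(\<integral>z. (sign_prod b J z - 1)\<^sup>2 \<partial>\<mu>2) \<le> real p * (b\<^sup>2 * 3)" .
    qed (use insert J in auto)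
    also have "\<dots> = real (card (insert j J)) * (3 * b ^ 4 * real p)"
      using insert.hyps by (simp add: power4_eq_xxxx power2_eq_square algebra_simps)
    finally show ?case .
  qed (simp add: sign_prod_def)
qed

text \<open>The product is split into 1, its linear part and a remainder. The linear part yields the
  negative main term, and the remainder is bounded in absolute mean through its second
  moment.\<close>

lemma integral_nonpos_ind_sign_prod:
  assumes b: "b > 0" "b\<^sup>2 * real p \<le> 1"
  shows "(\<integral>z. nonpos_ind z * sign_prod b {..<p} z \<partial>\<mu>2) \<le> (\<integral>z. nonpos_ind z \<partial>\<mu>2) - b * (3 * sqrt (real p) / 65536) + 2 * (b\<^sup>2 * real p)"
proof -
  let ?R = "\<lambda>z. sign_prod b {..<p} z - 1 - b * sign_sum z"
  \<comment> \<open>The remainder has second moment at most \<open>3 * c\<^sup>2\<close>, so the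
    choice of \<open>c\<close> in \<open>abs_le_AM_GM\<close> gives
    \<open>c / 2 + 3 * c / 2\<close>.\<close>
  define c where "c = b\<^sup>2 * real p"
  have c: "c > 0" using b p_pos by (simp add: c_def)
  have bR: "bdd_mble \<mu>2 ?R" by (intro bdd_intros bdd_sign_sum bdd_sign_prod) auto
  have "(\<integral>z. nonpos_ind z * sign_prod b {..<p} z \<partial>\<mu>2) \<le> (\<integral>z. nonpos_ind z + b * (nonpos_ind z * sign_sum z) + (c / 2 + (?R z)\<^sup>2 * (1 / (2 * c))) \<partial>\<mu>2)"
  proof (intro integral_mono bdd_integrable bdd_mble_add bdd_mble_mult bdd_mble_power bdd_mble_const bdd_nonpos_ind bdd_sign_sum bR bdd_sign_prod order_refl)
    fix z
    have "g * v \<le> \<bar>v\<bar>" if "g = 0 \<or> g = 1" for g v :: real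
      using that by auto
    then have "nonpos_ind z * ?R z \<le> \<bar>?R z\<bar>" by (simp add: nonpos_ind_def)
    also have "\<dots> \<le> c / 2 + (?R z)\<^sup>2 * (1 / (2 * c))" using abs_le_AM_GM[OF c, of "?R z"] by simp
    finally show "nonpos_ind z * sign_prod b {..<p} z \<le> nonpos_ind z + b * (nonpos_ind z * sign_sum z) + (c / 2 + (?R z)\<^sup>2 * (1 / (2 * c)))"
      by (simp add: algebra_simps)
  qed
  also have "\<dots> = (\<integral>z. nonpos_ind z + b * (nonpos_ind z * sign_sum z) \<partial>\<mu>2) + (\<integral>z. c / 2 + (?R z)\<^sup>2 * (1 / (2 * c)) \<partial>\<mu>2)"
    by (intro Bochner_Integration.integral_add bdd_integrable bdd_mble_add bdd_mble_mult bdd_mble_power bdd_mble_const bdd_nonpos_ind bdd_sign_sum bR)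
  also have "(\<integral>z. nonpos_ind z + b * (nonpos_ind z * sign_sum z) \<partial>\<mu>2) = (\<integral>z. nonpos_ind z \<partial>\<mu>2) + (\<integral>z. b * (nonpos_ind z * sign_sum z) \<partial>\<mu>2)"
    by (intro Bochner_Integration.integral_add bdd_integrable bdd_mble_mult bdd_mble_const bdd_nonpos_ind bdd_sign_sum)
  also have "(\<integral>z. b * (nonpos_ind z * sign_sum z) \<partial>\<mu>2) = b * (\<integral>z. nonpos_ind z * sign_sum z \<partial>\<mu>2)" by simp
  also have "(\<integral>z. c / 2 + (?R z)\<^sup>2 * (1 / (2 * c)) \<partial>\<mu>2) = (\<integral>z. c / 2 \<partial>\<mu>2) + (\<integral>z. (?R z)\<^sup>2 * (1 / (2 * c)) \<partial>\<mu>2)"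
    by (intro Bochner_Integration.integral_add bdd_integrable bdd_mble_mult bdd_mble_power bdd_mble_const bR)
  also have "(\<integral>z. (?R z)\<^sup>2 * (1 / (2 * c)) \<partial>\<mu>2) = (\<integral>z. (?R z)\<^sup>2 \<partial>\<mu>2) * (1 / (2 * c))" 
    by (rule integral_mult_left_zero)
  also have "(\<integral>z. c / 2 \<partial>\<mu>2) = c / 2" by (simp add: pair.P.prob_space)
  also have "(\<integral>z. nonpos_ind z \<partial>\<mu>2) + b * (\<integral>z. nonpos_ind z * sign_sum z \<partial>\<mu>2) + (c / 2 + (\<integral>z. (?R z)\<^sup>2 \<partial>\<mu>2) * (1 / (2 * c)))
    \<le> (\<integral>z. nonpos_ind z \<partial>\<mu>2) + b * (- (3 * sqrt (real p) / 65536)) + (c / 2 + (3 * c\<^sup>2) * (1 / (2 * c)))"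
  proof (intro add_mono mult_left_mono mult_right_mono integral_nonpos_ind_sign_sum order_refl)
    have "(\<integral>z. (?R z)\<^sup>2 \<partial>\<mu>2) \<le> real p * (3 * b ^ 4 * real p)"
      using second_moment_remainder[of "{..<p}" b] b by (simp add: sign_sum_def)
    also have "\<dots> = 3 * c\<^sup>2" by (simp add: c_def power_mult_distrib power4_eq_xxxx power2_eq_square)
    finally show "(\<integral>z. (?R z)\<^sup>2 \<partial>\<mu>2) \<le> 3 * c\<^sup>2" .
  qed (use b c in auto)
  also have "c / 2 + (3 * c\<^sup>2) * (1 / (2 * c)) = 2 * c"
    using c by (simp add: power2_eq_square)
  finally show ?thesis by (simp add: c_def)
qed

subsection \<open>The tilted distributions\<close>

definition tilt :: "real \<Rightarrow> (nat \<Rightarrow> real) \<Rightarrow> (nat \<Rightarrow> real) \<Rightarrow> real" where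
  "tilt a s x = (\<Prod>i<p. 1 + a * s i * sgn (x i))"

lemma bdd_tilt: "bdd_mble \<mu> (tilt a s)"
  unfolding tilt_def[abs_def] by (intro bdd_mble_intros bdd_coord) simp

text \<open>Almost everywhere the square of \<open>sgn (x j)\<close> is 1, so the factor of
  \<open>j\<close> is the constant \<open>1 + a\<^sup>2 * s j * t j\<close> plus a multiple of the
  sign; the latter is odd under \<open>flip j\<close> and drops out.\<close>

lemma integral_tilt_mult_tilt_aux:
  assumes "J \<subseteq> {..<p}"
  shows "(\<integral>x. (\<Prod>i\<in>J. (1 + a * s i * sgn (x i)) * (1 + a * t i * sgn (x i))) \<partial>\<mu>) = (\<Prod>i\<in>J. 1 + a\<^sup>2 * s i * t i)"
proof -
  have "finite J" using assms finite_subset by blast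
  then show ?thesis using assms
  proof (induction J)
    case (insert j J)
    then have j: "j < p" and J: "\<And>i. i \<in> J \<Longrightarrow> i < p" by auto
    define K where "K x = (\<Prod>i\<in>J. (1 + a * s i * sgn (x i)) * (1 + a * t i * sgn (x i)))" for x :: "nat \<Rightarrow> real"
    have bK: "bdd_mble \<mu> K" unfolding K_def[abs_def] by (intro bdd_mble_intros bdd_coord J)
    have K_flip: "K (flip j x) = K x" for x
      unfolding K_def using insert.hyps by (intro prod.cong) (auto simp: flip_def)
    have odd: "(\<integral>x. a * (s j + t j) * (sgn (x j) * K x) \<partial>\<mu>) = 0"
      by (rule integral_odd[OF j])
         (auto intro!: bdd_mble_measurable bdd_mble_intros bdd_coord j bK simp: K_flip, simp add: flip_def sgn_minus)
    have "(\<integral>x. (\<Prod>i\<in>insert j J. (1 + a * s i * sgn (x i)) * (1 + a * t i * sgn (x i))) \<partial>\<mu>)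
       = (\<integral>x. (1 + a\<^sup>2 * s j * t j) * K x + a * (s j + t j) * (sgn (x j) * K x) \<partial>\<mu>)"
    proof (intro integral_cong_AE)
      show "AE x in \<mu>. (\<Prod>i\<in>insert j J. (1 + a * s i * sgn (x i)) * (1 + a * t i * sgn (x i)))
         = (1 + a\<^sup>2 * s j * t j) * K x + a * (s j + t j) * (sgn (x j) * K x)"
        using AE_nonzero[OF j]
      proof eventually_elim
        case (elim x)
        then have "sgn (x j) * sgn (x j) = 1" by (simp add: sgn_if)
        then have "(1 + a * s j * sgn (x j)) * (1 + a * t j * sgn (x j)) = 1 + a\<^sup>2 * s j * t j + a * (s j + t j) * sgn (x j)"
          by (simp add: power2_eq_square algebra_simps)
        moreover have "(\<Prod>i\<in>insert j J. (1 + a * s i * sgn (x i)) * (1 + a * t i * sgn (x i)))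
            = ((1 + a * s j * sgn (x j)) * (1 + a * t j * sgn (x j))) * K x"
          using insert.hyps by (simp add: K_def)
        ultimately show ?case by (simp only: distrib_right mult.assoc)
      qed
    qed (use insert.prems in \<open>auto intro!: bdd_mble_measurable bdd_mble_intros bdd_coord j bK\<close>)
    also have "\<dots> = (\<integral>x. (1 + a\<^sup>2 * s j * t j) * K x \<partial>\<mu>) + (\<integral>x. a * (s j + t j) * (sgn (x j) * K x) \<partial>\<mu>)"
      by (intro Bochner_Integration.integral_add bdd_mble_integrable bdd_mble_intros bdd_coord j bK)
    also have "\<dots> = (1 + a\<^sup>2 * s j * t j) * (\<integral>x. K x \<partial>\<mu>)"
      unfolding odd by simp
    finally show ?case using insert by (simp add: K_def)
  qed (simp add: prob_space)
qed

lemma integral_tilt_mult_tilt: "(\<integral>x. tilt a s x * tilt a t x \<partial>\<mu>) = (\<Prod>i<p. 1 + a\<^sup>2 * s i * t i)"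
  using integral_tilt_mult_tilt_aux[of "{..<p}" a s t] by (simp add: tilt_def prod.distrib)

text \<open>With the zero vector for \<open>t\<close> the second tilt is identically 1.\<close>

lemma integral_tilt: "(\<integral>x. tilt a s x \<partial>\<mu>) = 1"
  using integral_tilt_mult_tilt[of a s "\<lambda>_. 0"] by (simp add: tilt_def)

text \<open>
  Flipping the \<open>i\<close>-th coordinate of both points leaves the inner product unchanged, so the terms
  of \<open>(1 + a s\<^sub>i sgn x\<^sub>i) (1 + a s\<^sub>i sgn y\<^sub>i)\<close> that are linear in the signs integrate to zero.
\<close>

lemma integral_nonpos_ind_tilt_aux:
  assumes "J \<subseteq> {..<p}" and s: "\<And>i. i \<in> J \<Longrightarrow> s i * s i = (1::real)"
    and "bdd_mble \<mu>2 H" "\<And>i z. i \<in> J \<Longrightarrow> H (flip2 i z) = H z"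
  shows "(\<integral>z. H z * (\<Prod>i\<in>J. (1 + a * s i * sgn (fst z i)) * (1 + a * s i * sgn (snd z i))) \<partial>\<mu>2)
    = (\<integral>z. H z * sign_prod (a\<^sup>2) J z \<partial>\<mu>2)"
proof -
  have "finite J" using assms finite_subset by blast
  then show ?thesis using assms
  \<comment> \<open>\<open>H\<close> varies because the factor left by coordinate \<open>j\<close>
    is absorbed into it before the induction hypothesis is applied.\<close>
  proof (induction J arbitrary: H)
    case (insert j J)
    then have j: "j < p" and J: "\<And>i. i \<in> J \<Longrightarrow> i < p" by auto
    define K where "K z = H z * (\<Prod>i\<in>J. (1 + a * s i * sgn (fst z i)) * (1 + a * s i * sgn (snd z i)))" for z
    have bK: "bdd_mble \<mu>2 K" unfolding K_def[abs_def] by (intro bdd_mble_intros bdd_fst bdd_snd J insert.prems)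
    have K_flip: "K (flip2 j z) = K z" for z
    proof -
      have "(\<Prod>i\<in>J. (1 + a * s i * sgn (fst (flip2 j z) i)) * (1 + a * s i * sgn (snd (flip2 j z) i)))
        = (\<Prod>i\<in>J. (1 + a * s i * sgn (fst z i)) * (1 + a * s i * sgn (snd z i)))"
        using insert.hyps by (intro prod.cong) (auto simp: flip2_def flip_def split: prod.split)
      then show ?thesis using insert.prems(4)[of j z] by (simp add: K_def)
    qed
    let ?O = "\<lambda>z. a * s j * (sgn (fst z j) + sgn (snd z j)) * K z"
    have "(\<integral>z. ?O z \<partial>\<mu>2) = 0"
    proof (rule integral_odd2[OF j])
      show "?O \<in> borel_measurable \<mu>2"
        by (intro bdd_mble_measurable bdd_mble_intros bdd_fst bdd_snd j bK)
      show "?O (flip2 j z) = - ?O z" for z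
        unfolding K_flip by (cases z) (simp add: flip2_def flip_def sgn_minus algebra_simps)
    qed
    moreover have "(\<integral>z. H z * (\<Prod>i\<in>insert j J. (1 + a * s i * sgn (fst z i)) * (1 + a * s i * sgn (snd z i))) \<partial>\<mu>2)
       = (\<integral>z. (1 + a\<^sup>2 * sgn (coord_prod j z)) * K z + ?O z \<partial>\<mu>2)"
    proof (intro Bochner_Integration.integral_cong refl)
      fix z
      have "(1 + a * s j * sgn (fst z j)) * (1 + a * s j * sgn (snd z j))
        = 1 + a * s j * (sgn (fst z j) + sgn (snd z j)) + a\<^sup>2 * (s j * s j) * (sgn (fst z j) * sgn (snd z j))"
        by (simp add: power2_eq_square algebra_simps)
      also have "\<dots> = 1 + a * s j * (sgn (fst z j) + sgn (snd z j)) + a\<^sup>2 * sgn (coord_prod j z)"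
        using insert.prems(2)[of j] by (simp add: coord_prod_def sgn_mult)
      finally show "H z * (\<Prod>i\<in>insert j J. (1 + a * s i * sgn (fst z i)) * (1 + a * s i * sgn (snd z i)))
        = (1 + a\<^sup>2 * sgn (coord_prod j z)) * K z + ?O z"
        using insert.hyps by (simp add: K_def algebra_simps)
    qed
    moreover have "(\<integral>z. (1 + a\<^sup>2 * sgn (coord_prod j z)) * K z + ?O z \<partial>\<mu>2) = (\<integral>z. (1 + a\<^sup>2 * sgn (coord_prod j z)) * K z \<partial>\<mu>2) + (\<integral>z. ?O z \<partial>\<mu>2)"
      by (intro Bochner_Integration.integral_add bdd_integrable bdd_intros bdd_fst bdd_snd j bK)
    moreover have "(\<integral>z. (1 + a\<^sup>2 * sgn (coord_prod j z)) * K z \<partial>\<mu>2)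
      = (\<integral>z. ((1 + a\<^sup>2 * sgn (coord_prod j z)) * H z) * sign_prod (a\<^sup>2) J z \<partial>\<mu>2)"
      unfolding K_def mult.assoc[symmetric]
    proof (rule insert.IH)
      show "bdd_mble \<mu>2 (\<lambda>z. (1 + a\<^sup>2 * sgn (coord_prod j z)) * H z)"
        by (intro bdd_intros j insert.prems)
    qed (use insert.prems in \<open>auto simp: coord_prod_flip2\<close>)
    moreover have "((1 + a\<^sup>2 * sgn (coord_prod j z)) * H z) * sign_prod (a\<^sup>2) J z = H z * sign_prod (a\<^sup>2) (insert j J) z" for z
      using insert.hyps by (simp add: sign_prod_def)
    ultimately show ?case by simp
  qed (simp add: sign_prod_def)
qed

lemma integral_nonpos_ind_tilt:
  assumes "\<And>i. i < p \<Longrightarrow> s i * s i = (1::real)"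
  shows "(\<integral>z. nonpos_ind z * (tilt a s (fst z) * tilt a s (snd z)) \<partial>\<mu>2) = (\<integral>z. nonpos_ind z * sign_prod (a\<^sup>2) {..<p} z \<partial>\<mu>2)"
  using integral_nonpos_ind_tilt_aux[of "{..<p}" s nonpos_ind a] assms bdd_nonpos_ind
  by (simp add: tilt_def prod.distrib nonpos_ind_flip2)

definition alternative :: "real \<Rightarrow> (nat \<Rightarrow> real) \<Rightarrow> (nat \<Rightarrow> real) measure" where
  "alternative a s = density \<mu> (\<lambda>x. ennreal (tilt a s x))"

lemma tilt_nonneg:
  assumes "0 \<le> a" "a \<le> 1" "s \<in> sign_vectors p"
  shows "tilt a s x \<ge> 0"
proof -
  have "1 + a * s i * sgn (x i) \<ge> 0" if "i < p" for i
    using sign_vectors_cases[OF assms(3) that] assms(1,2) by (auto simp: sgn_if)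
  then show ?thesis unfolding tilt_def by (intro prod_nonneg) auto
qed

lemma tilt_measurable [measurable]: "tilt a s \<in> borel_measurable \<mu>"
  by (rule bdd_mble_measurable[OF bdd_tilt])

lemma prob_space_alternative:
  assumes "0 \<le> a" "a \<le> 1" "s \<in> sign_vectors p"
  shows "prob_space (alternative a s)"
proof
  have "emeasure (alternative a s) (space (alternative a s)) = (\<integral>\<^sup>+x. ennreal (tilt a s x) \<partial>\<mu>)"
    by (simp add: alternative_def emeasure_density cong: nn_integral_cong)
  also have "\<dots> = ennreal (\<integral>x. tilt a s x \<partial>\<mu>)"
    by (intro nn_integral_eq_integral bdd_mble_integrable bdd_tilt) (simp add: tilt_nonneg assms)
  finally show "emeasure (alternative a s) (space (alternative a s)) = 1"
    by (simp add: integral_tilt)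
qed

lemma inner_cdf_0:
  assumes "space \<nu> = space \<mu>"
  shows "inner_cdf p \<nu> 0 = (\<integral>z. nonpos_ind z \<partial>(\<nu> \<Otimes>\<^sub>M \<nu>))"
proof -
  have "(\<integral>z. nonpos_ind z \<partial>(\<nu> \<Otimes>\<^sub>M \<nu>)) = (\<integral>z. indicator {z. dotp z \<le> 0} z \<partial>(\<nu> \<Otimes>\<^sub>M \<nu>))"
    by (simp add: nonpos_ind_def indicator_def of_bool_def)
  also have "\<dots> = measure (\<nu> \<Otimes>\<^sub>M \<nu>) ({z. dotp z \<le> 0} \<inter> space (\<nu> \<Otimes>\<^sub>M \<nu>))"
    by simp
  also have "{z. dotp z \<le> 0} \<inter> space (\<nu> \<Otimes>\<^sub>M \<nu>) = {(x, y) \<in> space (\<nu> \<Otimes>\<^sub>M \<nu>). (\<Sum>i<p. x i * y i) \<le> 0}"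
    by (auto simp: dotp_def coord_prod_def)
  finally show ?thesis by (simp add: inner_cdf_def)
qed

text \<open>The supremum is real-valued, so it dominates its value at \<open>t = 0\<close> only once
  the family is known to be bounded, here by 1.\<close>

lemma inner_dist_ge_0:
  assumes "prob_space \<nu>"
  shows "inner_dist p \<nu> \<mu> \<ge> \<bar>inner_cdf p \<nu> 0 - inner_cdf p \<mu> 0\<bar>"
proof -
  interpret \<nu>: prob_space \<nu> by fact
  interpret \<nu>2: pair_prob_space \<nu> \<nu> ..
  have "\<bar>inner_cdf p \<nu> t - inner_cdf p \<mu> t\<bar> \<le> 1" for t
    using \<nu>2.P.prob_le_1 pair.P.prob_le_1 unfolding inner_cdf_def
    by (smt (verit) measure_nonneg)
  then have "bdd_above ((\<lambda>t. \<bar>inner_cdf p \<nu> t - inner_cdf p \<mu> t\<bar>) ` {-1..1})"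
    by (intro bdd_aboveI2)
  then show ?thesis
    unfolding inner_dist_def by (intro cSUP_upper) auto
qed

text \<open>The distribution function of the inner product is compared at 0 alone; its value under
  the alternative, rewritten as an integral under the base measure, is smaller by the stated
  amount.\<close>

lemma inner_dist_alternative:
  assumes a: "0 < a" "a \<le> 1" and s: "s \<in> sign_vectors p" and b: "(a\<^sup>2)\<^sup>2 * real p \<le> 1"
  shows "inner_dist p (alternative a s) \<mu> \<ge> a\<^sup>2 * (3 * sqrt (real p) / 65536) - 2 * ((a\<^sup>2)\<^sup>2 * real p)"
proof -
  let ?\<nu> = "alternative a s"
  interpret \<nu>: prob_space ?\<nu> using a s by (intro prob_space_alternative) auto
  have pair_eq: "?\<nu> \<Otimes>\<^sub>M ?\<nu> = density \<mu>2 (\<lambda>z. ennreal (tilt a s (fst z) * tilt a s (snd z)))"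
    unfolding alternative_def
    using a s \<nu>.sigma_finite_measure_axioms sigma_finite_measure_axioms
    by (subst pair_measure_density) (auto simp: alternative_def split_beta' ennreal_mult tilt_nonneg)
  have bt: "bdd_mble \<mu>2 (\<lambda>z. tilt a s (fst z) * tilt a s (snd z))"
    by (intro bdd_mble_mult bdd_mble_compose[OF bdd_tilt measurable_fst] bdd_mble_compose[OF bdd_tilt measurable_snd])
  have "inner_cdf p ?\<nu> 0 = (\<integral>z. nonpos_ind z \<partial>(?\<nu> \<Otimes>\<^sub>M ?\<nu>))"
    by (intro inner_cdf_0) (simp add: alternative_def)
  also have "\<dots> = (\<integral>z. (tilt a s (fst z) * tilt a s (snd z)) *\<^sub>R nonpos_ind z \<partial>\<mu>2)"
    unfolding pair_eq using a s
    by (intro integral_density bdd_mble_measurable bdd_nonpos_ind bt) (simp add: tilt_nonneg)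
  also have "\<dots> = (\<integral>z. nonpos_ind z * (tilt a s (fst z) * tilt a s (snd z)) \<partial>\<mu>2)"
    by (simp add: mult.commute)
  also have "\<dots> = (\<integral>z. nonpos_ind z * sign_prod (a\<^sup>2) {..<p} z \<partial>\<mu>2)"
    using sign_vectors_cases[OF s] by (intro integral_nonpos_ind_tilt) fastforce
  also have "\<dots> \<le> (\<integral>z. nonpos_ind z \<partial>\<mu>2) - a\<^sup>2 * (3 * sqrt (real p) / 65536) + 2 * ((a\<^sup>2)\<^sup>2 * real p)"
    using a b by (intro integral_nonpos_ind_sign_prod) auto
  also have "(\<integral>z. nonpos_ind z \<partial>\<mu>2) = inner_cdf p \<mu> 0"
    by (simp add: inner_cdf_0)
  finally show ?thesis
    using inner_dist_ge_0[OF \<nu>.prob_space_axioms] by linarith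
qed

subsection \<open>Likelihood ratio of the mixture\<close>

text \<open>The likelihood ratio of the uniform mixture over all \<open>2 ^ p\<close> sign vectors
  against the null product measure.\<close>

definition mixture_ratio :: "nat \<Rightarrow> real \<Rightarrow> (nat \<Rightarrow> nat \<Rightarrow> real) \<Rightarrow> real" where
  "mixture_ratio n a X = (\<Sum>s\<in>sign_vectors p. \<Prod>j<n. tilt a s (X j)) / 2 ^ p"

lemma prob_space_sample: "prob_space (\<Pi>\<^sub>M j\<in>{..<n::nat}. \<mu>)"
  by (intro prob_space_PiM prob_space_axioms)

lemma bdd_prod_tilt: "bdd_mble (\<Pi>\<^sub>M j\<in>{..<n::nat}. \<mu>) (\<lambda>X. \<Prod>j<n. tilt a s (X j))"
  by (intro bdd_mble_prod bdd_mble_compose[OF bdd_tilt] measurable_component_singleton) auto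

lemma bdd_mixture_ratio: "bdd_mble (\<Pi>\<^sub>M j\<in>{..<n}. \<mu>) (mixture_ratio n a)"
  unfolding mixture_ratio_def[abs_def] divide_inverse
  by (intro bdd_mble_mult bdd_mble_sum bdd_mble_const bdd_prod_tilt)

lemma integral_prod_PiM:
  fixes n :: nat
  assumes "\<And>j. j < n \<Longrightarrow> bdd_mble \<mu> (f j)"
  shows "(\<integral>X. (\<Prod>j<n. f j (X j)) \<partial>(\<Pi>\<^sub>M j\<in>{..<n}. \<mu>)) = (\<Prod>j<n. \<integral>x. f j x \<partial>\<mu>)"
proof -
  interpret product_sigma_finite "\<lambda>_::nat. \<mu>" ..
  show ?thesis using assms by (intro product_integral_prod bdd_mble_integrable) auto
qed

lemma integral_mixture_ratio: "(\<integral>X. mixture_ratio n a X \<partial>(\<Pi>\<^sub>M j\<in>{..<n}. \<mu>)) = 1"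
proof -
  interpret M: prob_space "\<Pi>\<^sub>M j\<in>{..<n}. \<mu>" by (rule prob_space_sample)
  have "(\<integral>X. mixture_ratio n a X \<partial>(\<Pi>\<^sub>M j\<in>{..<n}. \<mu>))
    = (\<Sum>s\<in>sign_vectors p. \<integral>X. (\<Prod>j<n. tilt a s (X j)) \<partial>(\<Pi>\<^sub>M j\<in>{..<n}. \<mu>)) / 2 ^ p"
    unfolding mixture_ratio_def integral_divide_zero
    by (subst Bochner_Integration.integral_sum) (auto intro: M.bdd_mble_integrable bdd_prod_tilt)
  also have "\<dots> = (\<Sum>s\<in>sign_vectors p. 1) / 2 ^ p"
    by (subst integral_prod_PiM) (auto simp: bdd_tilt integral_tilt)
  finally show ?thesis by (simp add: card_sign_vectors)
qed

text \<open>The square is a double average over \<open>s\<close> and \<open>t\<close>. Independence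
  of the sample makes each term the \<open>n\<close>-th power of the overlap of two tilts, and the
  sum over \<open>t\<close> is the same for every \<open>s\<close>.\<close>

lemma second_moment_mixture_ratio:
  assumes "real n ^ 2 * (a\<^sup>2)\<^sup>2 * real p \<le> 1"
  shows "(\<integral>X. (mixture_ratio n a X)\<^sup>2 \<partial>(\<Pi>\<^sub>M j\<in>{..<n}. \<mu>)) \<le> 3"
proof -
  interpret M: prob_space "\<Pi>\<^sub>M j\<in>{..<n}. \<mu>" by (rule prob_space_sample)
  define b where "b = a\<^sup>2"
  let ?S = "sign_vectors p"
  have "(\<integral>X. (mixture_ratio n a X)\<^sup>2 \<partial>(\<Pi>\<^sub>M j\<in>{..<n}. \<mu>))
    = (\<integral>X. (\<Sum>s\<in>?S. \<Sum>t\<in>?S. \<Prod>j<n. tilt a s (X j) * tilt a t (X j)) / 4 ^ p \<partial>(\<Pi>\<^sub>M j\<in>{..<n}. \<mu>))"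
    by (simp add: mixture_ratio_def power_divide power2_eq_square sum_product prod.distrib flip: power_mult_distrib)
  also have "\<dots> = (\<Sum>s\<in>?S. \<Sum>t\<in>?S. \<integral>X. (\<Prod>j<n. tilt a s (X j) * tilt a t (X j)) \<partial>(\<Pi>\<^sub>M j\<in>{..<n}. \<mu>)) / 4 ^ p"
  proof -
    have b: "bdd_mble (\<Pi>\<^sub>M j\<in>{..<n}. \<mu>) (\<lambda>X. \<Prod>j<n. tilt a s (X j) * tilt a t (X j))" for s t
      by (intro bdd_mble_prod bdd_mble_mult bdd_mble_compose[OF bdd_tilt] measurable_component_singleton) auto
    show ?thesis
      unfolding integral_divide_zero
      by (subst Bochner_Integration.integral_sum, intro M.bdd_mble_integrable bdd_mble_sum b,
          subst Bochner_Integration.integral_sum, intro M.bdd_mble_integrable b, rule refl)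
  qed
  also have "\<dots> = (\<Sum>s\<in>?S. \<Sum>t\<in>?S. (\<Prod>i<p. 1 + b * s i * t i) ^ n) / 4 ^ p"
    by (subst integral_prod_PiM) (auto intro: bdd_mble_mult bdd_tilt simp: integral_tilt_mult_tilt b_def)
  also have "\<dots> = (\<Sum>s\<in>?S. ((1 + b) ^ n + (1 - b) ^ n) ^ p) / 4 ^ p"
    by (simp add: sum_sign_vectors_prod)
  also have "\<dots> = (((1 + b) ^ n + (1 - b) ^ n) / 2) ^ p"
    by (simp add: card_sign_vectors power_divide flip: power_mult_distrib)
      (simp add: field_simps flip: power_mult_distrib)
  also have "\<dots> \<le> (1 + (real n * b)\<^sup>2) ^ p"
  proof (intro power_mono)
    have nb: "(real n * b)\<^sup>2 * real p \<le> 1" using assms by (simp add: b_def power_mult_distrib)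
    have "(real n * b)\<^sup>2 * 1 \<le> (real n * b)\<^sup>2 * real p"
      using p_pos by (intro mult_left_mono) auto
    with nb have "(real n * b)\<^sup>2 \<le> 1" by linarith
    then have nb1: "real n * b \<le> 1" by (simp add: abs_square_le_1 abs_le_iff)
    show "((1 + b) ^ n + (1 - b) ^ n) / 2 \<le> 1 + (real n * b)\<^sup>2"
      "0 \<le> ((1 + b) ^ n + (1 - b) ^ n) / 2"
      using nb1 by (intro mean_power_pm_le; simp add: b_def)+
  qed
  also have "\<dots> \<le> exp ((real n * b)\<^sup>2) ^ p"
    by (intro power_mono) auto
  also have "\<dots> = exp ((real n * b)\<^sup>2 * real p)"
    by (simp add: exp_of_nat_mult mult.commute)
  also have "\<dots> \<le> exp 1" using assms by (simp add: b_def power_mult_distrib)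
  also have "\<dots> \<le> 3" by (rule exp_le)
  finally show ?thesis .
qed

section \<open>Error probabilities against the mixture\<close>

lemma measure_PiM_alternative:
  fixes n :: nat
  assumes a: "0 \<le> a" "a \<le> 1" and s: "s \<in> sign_vectors p" and A: "A \<in> sets (\<Pi>\<^sub>M j\<in>{..<n}. \<mu>)"
  shows "measure (\<Pi>\<^sub>M j\<in>{..<n}. alternative a s) A = (\<integral>X. (\<Prod>j<n. tilt a s (X j)) * indicator A X \<partial>(\<Pi>\<^sub>M j\<in>{..<n}. \<mu>))"
proof -
  interpret \<nu>: prob_space "alternative a s" using a s by (intro prob_space_alternative) auto
  have "(\<Pi>\<^sub>M j\<in>{..<n}. alternative a s) = density (\<Pi>\<^sub>M j\<in>{..<n}. \<mu>) (\<lambda>X. \<Prod>j<n. ennreal (tilt a s (X j)))"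
    using \<nu>.sigma_finite_measure_axioms sigma_finite_measure_axioms unfolding alternative_def
    by (intro PiM_density) auto
  also have "\<dots> = density (\<Pi>\<^sub>M j\<in>{..<n}. \<mu>) (\<lambda>X. ennreal (\<Prod>j<n. tilt a s (X j)))"
    using a s by (simp add: prod_ennreal tilt_nonneg)
  finally have eq: "(\<Pi>\<^sub>M j\<in>{..<n}. alternative a s) = density (\<Pi>\<^sub>M j\<in>{..<n}. \<mu>) (\<lambda>X. ennreal (\<Prod>j<n. tilt a s (X j)))" .
  have "A \<inter> space (\<Pi>\<^sub>M j\<in>{..<n}. \<mu>) = A"
    using sets.sets_into_space[OF A] by auto
  then have "measure (\<Pi>\<^sub>M j\<in>{..<n}. alternative a s) A = (\<integral>X. indicator A X \<partial>(\<Pi>\<^sub>M j\<in>{..<n}. alternative a s))"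
    by (simp add: eq)
  also have "\<dots> = (\<integral>X. (\<Prod>j<n. tilt a s (X j)) *\<^sub>R indicator A X \<partial>(\<Pi>\<^sub>M j\<in>{..<n}. \<mu>))"
    unfolding eq using A a s
    by (intro integral_density bdd_mble_measurable[OF bdd_prod_tilt]) (auto intro!: AE_I2 prod_nonneg simp: tilt_nonneg)
  finally show ?thesis by simp
qed

text \<open>Here \<open>A\<close> is rejection under the null and \<open>B\<close> acceptance under
  the alternative. The bound is shown for the average over \<open>s\<close>, so it holds for some
  \<open>s\<close>; as every point lies in \<open>A\<close> or \<open>B\<close>, the integrand for
  the average dominates the minimum of 1 and the likelihood ratio.\<close>

lemma sum_of_errors_ge:
  assumes a: "0 \<le> a" "a \<le> 1" and small: "real n ^ 2 * (a\<^sup>2)\<^sup>2 * real p \<le> 1"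
    and A: "A \<in> sets (\<Pi>\<^sub>M j\<in>{..<n}. \<mu>)" and B: "B \<in> sets (\<Pi>\<^sub>M j\<in>{..<n}. \<mu>)"
    and AB: "space (\<Pi>\<^sub>M j\<in>{..<n}. \<mu>) \<subseteq> A \<union> B"
  shows "\<exists>s\<in>sign_vectors p. measure (\<Pi>\<^sub>M j\<in>{..<n}. \<mu>) A + measure (\<Pi>\<^sub>M j\<in>{..<n}. alternative a s) B \<ge> 1 / 4"
proof -
  let ?M = "\<Pi>\<^sub>M j\<in>{..<n}. \<mu>" and ?l = "mixture_ratio n a" and ?S = "sign_vectors p"
  interpret M: prob_space ?M by (rule prob_space_sample)
  let ?\<beta> = "\<lambda>s. measure (\<Pi>\<^sub>M j\<in>{..<n}. alternative a s) B"
  have bdd_ind: "bdd_mble ?M (indicator C)" if "C \<in> sets ?M" for C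
    using that by (intro bdd_mbleI[where B=1]) (auto simp: indicator_def)
  have l_nonneg: "?l X \<ge> 0" for X
    unfolding mixture_ratio_def using a by (intro divide_nonneg_nonneg sum_nonneg prod_nonneg) (auto simp: tilt_nonneg)
  have "(\<Sum>s\<in>?S. ?\<beta> s) / 2 ^ p = (\<Sum>s\<in>?S. \<integral>X. (\<Prod>j<n. tilt a s (X j)) * indicator B X \<partial>?M) / 2 ^ p"
    using a B by (simp add: measure_PiM_alternative)
  also have "\<dots> = (\<integral>X. (\<Sum>s\<in>?S. (\<Prod>j<n. tilt a s (X j)) * indicator B X) / 2 ^ p \<partial>?M)"
    unfolding integral_divide_zero
    by (subst Bochner_Integration.integral_sum) (auto intro!: M.bdd_mble_integrable bdd_mble_mult bdd_prod_tilt bdd_ind B)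
  also have "\<dots> = (\<integral>X. ?l X * indicator B X \<partial>?M)"
    by (simp add: mixture_ratio_def sum_distrib_right)
  finally have \<beta>: "(\<Sum>s\<in>?S. ?\<beta> s) / 2 ^ p = (\<integral>X. ?l X * indicator B X \<partial>?M)" .
  have int_l: "integrable ?M ?l" "integrable ?M (\<lambda>X. (?l X)\<^sup>2)"
    by (intro M.bdd_mble_integrable bdd_mble_power bdd_mixture_ratio)+
  \<comment> \<open>The likelihood ratio has mean 1 and second moment at most 3.\<close>
  have "1 - 3 / 4 \<le> (\<integral>X. ?l X \<partial>?M) - (\<integral>X. (?l X)\<^sup>2 \<partial>?M) / 4"
    using second_moment_mixture_ratio[OF small] by (simp add: integral_mixture_ratio)
  also have "\<dots> = (\<integral>X. ?l X - (?l X)\<^sup>2 / 4 \<partial>?M)"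
    using int_l by simp
  also have "\<dots> \<le> (\<integral>X. indicator A X + ?l X * indicator B X \<partial>?M)"
  proof (rule integral_mono)
    show "integrable ?M (\<lambda>X. indicator A X + ?l X * indicator B X)"
      by (intro M.bdd_mble_integrable bdd_mble_add bdd_mble_mult bdd_ind A B bdd_mixture_ratio)
    show "integrable ?M (\<lambda>X. ?l X - (?l X)\<^sup>2 / 4)"
      using int_l by simp
    fix X assume X: "X \<in> space ?M"
    have "0 \<le> (?l X / 2 - 1)\<^sup>2" by simp
    then have "?l X - (?l X)\<^sup>2 / 4 \<le> 1" by (simp add: power2_eq_square algebra_simps)
    moreover have "?l X - (?l X)\<^sup>2 / 4 \<le> ?l X" by simp
    moreover have "X \<in> A \<or> X \<in> B" using X AB by auto
    ultimately show "?l X - (?l X)\<^sup>2 / 4 \<le> indicator A X + ?l X * indicator B X"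
      using l_nonneg[of X] by (auto simp: indicator_def)
  qed
  also have "\<dots> = (\<integral>X. indicator A X \<partial>?M) + (\<integral>X. ?l X * indicator B X \<partial>?M)"
    by (intro Bochner_Integration.integral_add M.bdd_mble_integrable bdd_mble_mult bdd_ind A B bdd_mixture_ratio)
  also have "(\<integral>X. indicator A X \<partial>?M) = measure ?M A"
    using sets.sets_into_space[OF A] by (simp add: Int_absorb2)
  finally have avg: "1 / 4 \<le> measure ?M A + (\<Sum>s\<in>?S. ?\<beta> s) / 2 ^ p"
    unfolding \<beta> by simp
  show ?thesis
  proof (rule ccontr)
    assume "\<not> ?thesis"
    then have "\<forall>s\<in>?S. ?\<beta> s < 1 / 4 - measure ?M A" by auto
    moreover have "?S \<noteq> {}" using card_sign_vectors[of p] by auto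
    ultimately have "(\<Sum>s\<in>?S. ?\<beta> s) < (\<Sum>s\<in>?S. 1 / 4 - measure ?M A)"
      by (intro sum_strict_mono finite_sign_vectors) auto
    then have "(\<Sum>s\<in>?S. ?\<beta> s) / 2 ^ p < 1 / 4 - measure ?M A"
      by (simp add: card_sign_vectors pos_divide_less_eq mult.commute)
    with avg show False by linarith
  qed
qed

text \<open>The scale \<open>b = 1 / (real n * sqrt (real p))\<close> meets both demands: it keeps
  the second moment of the likelihood ratio bounded and separates every tilted alternative from the
  null at order \<open>1 / real n\<close>. The sign vector chosen by the test is thus admissible in
  the supremum.\<close>

lemma minimax_lower_bound:
  assumes n: "n \<ge> 65536" and \<epsilon>: "\<epsilon> \<le> 1 / 65536" and \<phi>: "\<phi> \<in> sphere_tests p n"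
  shows "1 / 4 \<le> test_prob n \<mu> \<phi> 1 + (SUP \<nu>\<in>{\<nu> \<in> sphere_probs p. inner_dist p \<nu> \<mu> \<ge> \<epsilon> / real n}. test_prob n \<nu> \<phi> 0)"
proof -
  let ?M = "\<Pi>\<^sub>M j\<in>{..<n}. \<mu>"
  define b where "b = 1 / (real n * sqrt (real p))"
  define a where "a = sqrt b"
  have b: "b > 0" "b \<le> 1"
  proof -
    show "b > 0" using n p_pos by (simp add: b_def)
    have "1 * 1 \<le> real n * sqrt (real p)" using n p_pos by (intro mult_mono) auto
    then show "b \<le> 1" by (simp add: b_def)
  qed
  then have a: "0 < a" "a \<le> 1" "a\<^sup>2 = b" by (auto simp: a_def)
  have bp: "b\<^sup>2 * real p = 1 / (real n)\<^sup>2"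
    using p_pos by (simp add: b_def power_divide power_mult_distrib)
  then have nb: "(real n)\<^sup>2 * b\<^sup>2 * real p \<le> 1" by (simp add: mult.assoc)
  have sets_M: "sets ?M = sets (\<Pi>\<^sub>M i\<in>{..<n}. sphere_borel p)"
    by (intro sets_PiM_cong sets_\<mu> refl)
  have \<phi>_meas: "\<phi> \<in> measurable ?M (count_space {0, 1})"
    using \<phi> measurable_cong_sets[OF sets_M refl] unfolding sphere_tests_def by blast
  define E where "E k = {X \<in> space ?M. \<phi> X = k}" for k
  have E: "E k \<in> sets ?M" for k
  proof -
    \<comment> \<open>Intersecting with \<open>{0, 1}\<close> gives a measurable set of the count
      space for every \<open>k\<close>.\<close>
    have "E k = \<phi> -` ({k} \<inter> {0, 1}) \<inter> space ?M"
      using measurable_space[OF \<phi>_meas] by (auto simp: E_def)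
    then show ?thesis using measurable_sets[OF \<phi>_meas, of "{k} \<inter> {0, 1}"] by simp
  qed
  have "space ?M \<subseteq> E 1 \<union> E 0"
  proof
    fix X assume X: "X \<in> space ?M"
    then have "\<phi> X \<in> {0, 1}" using measurable_space[OF \<phi>_meas] by simp
    with X show "X \<in> E 1 \<union> E 0" by (auto simp: E_def)
  qed
  from sum_of_errors_ge[OF _ _ _ E E this, of a] obtain s where
    s: "s \<in> sign_vectors p" and err: "1 / 4 \<le> measure ?M (E 1) + measure (\<Pi>\<^sub>M j\<in>{..<n}. alternative a s) (E 0)"
    using a nb by auto
  let ?\<nu> = "alternative a s"
  interpret \<nu>: prob_space ?\<nu> using a s by (intro prob_space_alternative) auto
  interpret M: prob_space ?M by (rule prob_space_sample)
  interpret M\<nu>: prob_space "\<Pi>\<^sub>M j\<in>{..<n}. ?\<nu>" by (intro prob_space_PiM \<nu>.prob_space_axioms)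
  have sp: "space (\<Pi>\<^sub>M j\<in>{..<n}. ?\<nu>) = space ?M"
    by (simp add: space_PiM alternative_def)
  have "?\<nu> \<in> sphere_probs p"
    using \<nu>.prob_space_axioms by (simp add: sphere_probs_def alternative_def sets_\<mu>)
  moreover have "inner_dist p ?\<nu> \<mu> \<ge> \<epsilon> / real n"
  proof -
    have "(a\<^sup>2)\<^sup>2 * real p \<le> 1"
      using n unfolding a bp by simp
    from inner_dist_alternative[OF a(1,2) s this]
    have "inner_dist p ?\<nu> \<mu> \<ge> b * (3 * sqrt (real p) / 65536) - 2 / (real n)\<^sup>2"
      unfolding a bp by simp
    moreover have "b * (3 * sqrt (real p) / 65536) = 3 / 65536 / real n"
      using p_pos n by (simp add: b_def)
    \<comment> \<open>From \<open>n \<ge> 65536\<close> the quadratic loss uses at most two of the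
      three units of \<open>1 / 65536 / real n\<close> gained; the third covers
      \<open>\<epsilon> / real n\<close>.\<close>
    moreover have "2 / (real n)\<^sup>2 \<le> 2 / 65536 / real n"
      using n by (simp add: power2_eq_square field_simps)
    moreover have "\<epsilon> / real n \<le> 1 / 65536 / real n"
      using \<epsilon> by (intro divide_right_mono) auto
    ultimately show ?thesis by linarith
  qed
  ultimately have sup: "test_prob n ?\<nu> \<phi> 0 \<le> (SUP \<nu>\<in>{\<nu> \<in> sphere_probs p. inner_dist p \<nu> \<mu> \<ge> \<epsilon> / real n}. test_prob n \<nu> \<phi> 0)"
    by (intro SUP_upper) auto
  have "1 / 4 = ennreal (1 / 4)"
    using ennreal_divide_numeral[of 1 "num.Bit0 (num.Bit0 num.One)"] by simp
  also have "\<dots> \<le> ennreal (measure ?M (E 1) + measure (\<Pi>\<^sub>M j\<in>{..<n}. ?\<nu>) (E 0))"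
    by (rule ennreal_leI[OF err])
  also have "\<dots> = ennreal (measure ?M (E 1)) + ennreal (measure (\<Pi>\<^sub>M j\<in>{..<n}. ?\<nu>) (E 0))"
    by (intro ennreal_plus measure_nonneg)
  also have "\<dots> = test_prob n \<mu> \<phi> 1 + test_prob n ?\<nu> \<phi> 0"
    unfolding test_prob_def M.emeasure_eq_measure M\<nu>.emeasure_eq_measure sp E_def ..
  also have "\<dots> \<le> test_prob n \<mu> \<phi> 1 + (SUP \<nu>\<in>{\<nu> \<in> sphere_probs p. inner_dist p \<nu> \<mu> \<ge> \<epsilon> / real n}. test_prob n \<nu> \<phi> 0)"
    by (rule add_left_mono[OF sup])
  finally show ?thesis .
qed

end

text \<open>The bound holds for every test at each single \<open>n\<close> once
  \<open>min (p n) n\<close> reaches 65536, hence for the infimum over tests and then for the limit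
  inferior.\<close>

theorem theorem3:
  fixes p :: "nat \<Rightarrow> nat"
  assumes "filterlim (\<lambda>n. min (p n) n) at_top sequentially"
  shows "\<forall>\<^sub>F \<epsilon> in at_right (0::real).
           liminf (\<lambda>n. INF \<phi>\<in>sphere_tests (p n) n.
             test_prob n (uniform_sphere (p n)) \<phi> 1 +
             (SUP \<nu>\<in>{\<nu> \<in> sphere_probs (p n).
                      inner_dist (p n) \<nu> (uniform_sphere (p n)) \<ge> \<epsilon> / real n}.
                test_prob n \<nu> \<phi> 0)) \<ge> 1 / 4"
proof (rule eventually_at_rightI[of 0 "1 / 65536"])
  fix \<epsilon> :: real
  assume "\<epsilon> \<in> {0<..<1 / 65536}"
  then have \<epsilon>: "\<epsilon> \<le> 1 / 65536" by simp
  have "\<forall>\<^sub>F n in sequentially. 65536 \<le> min (p n) n"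
    using assms by (simp only: filterlim_at_top)
  then show "1 / 4 \<le> liminf (\<lambda>n. INF \<phi>\<in>sphere_tests (p n) n.
             test_prob n (uniform_sphere (p n)) \<phi> 1 +
             (SUP \<nu>\<in>{\<nu> \<in> sphere_probs (p n).
                      inner_dist (p n) \<nu> (uniform_sphere (p n)) \<ge> \<epsilon> / real n}.
                test_prob n \<nu> \<phi> 0))"
  proof (intro Liminf_bounded, elim eventually_mono)
    fix n
    assume n: "65536 \<le> min (p n) n"
    then interpret isotropic_sphere_measure "uniform_sphere (p n)" "p n"
      by (intro isotropic_uniform_sphere) simp
    show "1 / 4 \<le> (INF \<phi>\<in>sphere_tests (p n) n.
             test_prob n (uniform_sphere (p n)) \<phi> 1 +
             (SUP \<nu>\<in>{\<nu> \<in> sphere_probs (p n).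
                      inner_dist (p n) \<nu> (uniform_sphere (p n)) \<ge> \<epsilon> / real n}.
                test_prob n \<nu> \<phi> 0))"
      using n \<epsilon> by (intro INF_greatest minimax_lower_bound) auto
  qed
qed simp

end
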